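(* For any fixed-point context $\Upsilon_{\bar c}$ and nominal terms $t,u$: 1. (Soundness) If $\Upsilon_{\bar c}\vdash t\approx_C u$ then $\Upsilon_{\bar c}\vDash t\approx_C u$. 2. (Completeness) If $\Upsilon_{\bar c}\vDash t\approx_C u$ then $\Upsilon_{\bar c}\vdash t\approx_C u$.
   Context: Syntax. Fix disjoint countably infinite sets $\mathbb{A}$ of atoms and $\mathcal{V}$ of variables, and a signature $\Sigma$ of term-formers with arities; some binary term-formers are designated commutative and written $\mathsf{f}^C$. Finite permutations $\pi$ of $\mathbb{A}$ (finite $\mathrm{dom}(\pi)=\{a\mid\pi(a)\ne a\}$) are written as products of disjoint cycles; $(a\ b)$ is a swapping. For $B\subseteq\mathbb{A}$, $\mathrm{Perm}(B)=\{\pi\mid\mathrm{dom}(\pi)\subseteq B\}$; $\langle S\rangle$ is the group generated by $S$; $H\circ K=\{h\circ k\mid h\in H,k\in K\}$. Nominal terms: $t::=a\mid\pi\cdot X\mid\mathsf{f}(t_1,\ldots,t_n)\mid[a]t$. Permutation action on terms: $\pi\cdot a=\pi(a)$, $\pi\cdot(\pi'\cdot X)=(\pi\circ\pi')\cdot X$, $\pi\cdot[a]t=[\pi(a)](\pi\cdot t)$, $\pi\cdot\mathsf{f}(\vec t)=\mathsf{f}(\pi\cdot\vec t)$. Contexts and proof system. For a finite list of names $\bar c$ and a permutation $\pi$, $\pi_{\bar c}$ is the product of the disjoint cycles of $\pi$ mentioning some atom of $\bar c$ and $\pi_{\neg\bar c}$ the product of the others. A fixed-point context $\Upsilon_{\bar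 c}$ (also written $\mathsf{N}\bar c.\Upsilon$) is a finite list $\bar c$ of distinct atoms together with a finite set $\Upsilon$ of constraints $\pi\curlywedge X$ (meaning $\pi\cdot X\approx_C X$; $\pi$ may mention atoms of $\bar c$), assumed in normal form under exhaustive application of (R1) replace $\pi\curlywedge X$ by $\pi_{\bar c}\curlywedge X$ and $\pi_{\neg\bar c}\curlywedge X$, then (R2): if $\pi\curlywedge X$ with $\pi=\pi_{\bar c}$ and $(\rho\circ\rho')\curlywedge X$ with no cycle meeting $\bar c$, $\rho$ a cycle disjoint from $\rho'$ and $\mathrm{dom}(\pi)\cap\mathrm{dom}(\rho)\ne\emptyset$, replace them by $(\pi\circ\rho)\curlywedge X$ and $\rho'\curlywedge X$. Let $F_X$ consist of the atoms of $\bar c$ and the atoms of $\mathrm{dom}(\pi)$ for all $\pi\curlywedge X\in\Upsilon$ with $\pi=\pi_{\bar c}$; $P_X=\{\pi_{\neg\bar c}\mid\pi\curlywedge X\in\Upsilon\}$; $\mathrm{PN}(\Upsilon_{\bar c}|_X)=\mathrm{Perm}(F_X)\circ\langle P_X\rangle$. $\Upsilon_{\bar c}\vdash t\approx_C u$ is the least relation closed under: $\Upsilon_{\bar c}\vdash a\approx_C a$; $\Upsilon_{\bar c}\vdash\pi\cdot X\approx_C\pi'\cdot X$ if $\pi'^{-1}\circ\pi\in\mathrm{PN}(\Upsilon_{\bar c}|_X)$; componentwise rule for non-commutative $\mathsf{f}$; $\Upsilon_{\bar c}\vdash\mathsf{f}^C(s_0,s_1)\approx_C\mathsf{f}^C(t_0,t_1)$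 if for some $i\in\{0,1\}$, $\Upsilon_{\bar c}\vdash s_0\approx_C t_i$ and $\Upsilon_{\bar c}\vdash s_1\approx_C t_{1-i}$; $\Upsilon_{\bar c}\vdash[a]t\approx_C[a]t'$ if $\Upsilon_{\bar c}\vdash t\approx_C t'$; $\Upsilon_{\bar c}\vdash[a]t\approx_C[b]s$ if $\Upsilon_{\bar c,c_1}\vdash(a\ c_1)\cdot t\approx_C(b\ c_1)\cdot s$ for a new atom $c_1$ not occurring in $\Upsilon_{\bar c},a,b,t,s$ (here $\Upsilon_{\bar c,c_1}$ is $\Upsilon$ with $c_1$ added to the quantified names). Semantics. A nominal set is a set with an action of the group of finite permutations whose elements have finite support ($B$ supports $x$ if every permutation fixing $B$ pointwise fixes $x$); $\mathrm{supp}(x)$ is the least finite support. For a property $\phi$ of atoms, $\mathsf{N}a.\phi(a)$ holds iff $\{a\mid\phi(a)\}$ is cofinite; $\mathsf{N}\bar c.\phi$ abbreviates $\mathsf{N}c_1.\cdots\mathsf{N}c_n.\phi$. A map $f$ is equivariant if $\pi\cdot f(x)=f(\pi\cdot x)$. A commutative nominal $\Sigma$-algebra $\mathcal{A}$ consists of a nominal set $|\mathcal{A}|$, an injective equivariant map $a\mapsto a^{\mathcal A}$ from $\mathbb A$ to $|\mathcal A|$, an equivariant map $\mathrm{abs}^{\mathcal A}:\mathbb{A}\times|\mathcal A|\to|\mathcal A|$ with $\mathsf{N}c.(a\ c)\cdot\mathrm{abs}^{\mathcal A}(a,x)=\mathrm{abs}^{\mathcal A}(a,x)$ for all $a,x$,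 an equivariant $f^{\mathcal A}:|\mathcal A|^n\to|\mathcal A|$ for each $\mathsf{f}:n$ in $\Sigma$, with $f^{\mathcal A}(x_1,x_2)=f^{\mathcal A}(x_2,x_1)$ for each commutative $\mathsf f^C$. A valuation $\varsigma$ maps variables to elements of $|\mathcal A|$; the interpretation is $[\![a]\!]_\varsigma=a^{\mathcal A}$, $[\![\pi\cdot X]\!]_\varsigma=\pi\cdot\varsigma(X)$, $[\![\mathsf f(t_1,\ldots,t_n)]\!]_\varsigma=f^{\mathcal A}([\![t_1]\!]_\varsigma,\ldots)$, $[\![[a]t]\!]_\varsigma=\mathrm{abs}^{\mathcal A}(a,[\![t]\!]_\varsigma)$. $\Upsilon_{\bar c}$ is valid under $\varsigma$ if $\mathsf{N}\bar c.\,\pi\cdot\varsigma(X)=\varsigma(X)$ for each $\pi\curlywedge X\in\Upsilon$; the judgement $\Upsilon_{\bar c}\vdash t\approx_C u$ is valid under $\varsigma$ if validity of $\Upsilon_{\bar c}$ under $\varsigma$ implies $[\![t]\!]_\varsigma=[\![u]\!]_\varsigma$. $\Upsilon_{\bar c}\vDash t\approx_C u$ means this judgement is valid in every commutative nominal $\Sigma$-algebra under every valuation.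
   Formalization: Validity of a judgement is taken with the quantified names bound in t and u too (context valid implies N c̄. [[t]]=[[u]]), since with plain [[t]]=[[u]] soundness fails: c̄=(a,b), no constraints, (a b)·X ≈ X, X↦a. Both readings agree when c̄ does not occur in t, u. *)

theory Defs
  imports
    "HOL-Combinatorics.Perm"
    "HOL-Algebra.Generated_Groups"
    "HOL-Library.Countable_Set"
begin

unbundle permutation_syntax

section \<open>Permutations\<close>

text \<open>
  The library type \<open>'a perm\<close> consists of the permutations of \<open>'a\<close> that move only finitely many
  elements; \<open>affected \<pi>\<close> is \<open>dom(\<pi>)\<close>, multiplication is composition, \<open>\<langle>a \<leftrightarrow> b\<rangle>\<close> is a swapping.
  The cycles of \<open>\<pi>\<close> are its nontrivial orbits, so a product of some of its cycles agrees with \<open>\<pi>\<close> on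
  the chosen orbits and is the identity elsewhere.
\<close>

definition cycles_meeting :: "'a list \<Rightarrow> 'a perm \<Rightarrow> 'a perm" where
  "cycles_meeting cs \<pi> = Perm (\<lambda>a. if Perm.orbit \<pi> a \<inter> set cs \<noteq> {} then \<pi> \<langle>$\<rangle> a else a)"

definition cycles_avoiding :: "'a list \<Rightarrow> 'a perm \<Rightarrow> 'a perm" where
  "cycles_avoiding cs \<pi> = Perm (\<lambda>a. if Perm.orbit \<pi> a \<inter> set cs = {} then \<pi> \<langle>$\<rangle> a else a)"

lemma apply_Perm_on_orbits:
  "Perm (\<lambda>a. if Q (Perm.orbit \<pi> a) then \<pi> \<langle>$\<rangle> a else a) \<langle>$\<rangle> a =
    (if Q (Perm.orbit \<pi> a) then \<pi> \<langle>$\<rangle> a else a)"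
proof -
  let ?f = "\<lambda>a. if Q (Perm.orbit \<pi> a) then \<pi> \<langle>$\<rangle> a else a"
  let ?g = "\<lambda>a. if Q (Perm.orbit \<pi> a) then inverse \<pi> \<langle>$\<rangle> a else a"
  have inv: "\<pi> \<langle>$\<rangle> (inverse \<pi> \<langle>$\<rangle> b) = b" "inverse \<pi> \<langle>$\<rangle> (\<pi> \<langle>$\<rangle> b) = b" for b
    by (simp_all add: apply_sequence)
  have "bij ?f"
    by (rule o_bij[where g = ?g]) (auto simp: fun_eq_iff inv)
  moreover have "finite {a. ?f a \<noteq> a}"
    by (rule finite_subset[OF _ finite_affected[of \<pi>]]) (auto simp: in_affected)
  ultimately show ?thesis
    by (simp add: Perm_inverse)
qed

lemma apply_cycles_meeting:
  "cycles_meeting cs \<pi> \<langle>$\<rangle> a = (if Perm.orbit \<pi> a \<inter> set cs \<noteq> {} then \<pi> \<langle>$\<rangle> a else a)"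
  unfolding cycles_meeting_def by (rule apply_Perm_on_orbits[where Q = "\<lambda>S. S \<inter> set cs \<noteq> {}"])

lemma apply_cycles_avoiding:
  "cycles_avoiding cs \<pi> \<langle>$\<rangle> a = (if Perm.orbit \<pi> a \<inter> set cs = {} then \<pi> \<langle>$\<rangle> a else a)"
  unfolding cycles_avoiding_def by (rule apply_Perm_on_orbits[where Q = "\<lambda>S. S \<inter> set cs = {}"])

definition is_cycle :: "'a perm \<Rightarrow> bool" where
  "is_cycle \<rho> \<longleftrightarrow> (\<exists>a \<in> affected \<rho>. Perm.orbit \<rho> a = affected \<rho>)"

definition Perms_on :: "'a set \<Rightarrow> 'a perm set" where
  "Perms_on B = {\<pi>. affected \<pi> \<subseteq> B}"

definition perm_group :: "'a perm monoid" where
  "perm_group = \<lparr>carrier = UNIV, mult = (*), one = 1\<rparr>"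

lemma group_perm_group: "group (perm_group :: 'a perm monoid)"
  by (rule groupI) (auto simp: perm_group_def mult.assoc intro: perm.left_inverse)


section \<open>Nominal terms\<close>

datatype ('a, 'v, 'f) trm =
    Atom 'a
  | Susp "'a perm" 'v
  | App 'f "('a, 'v, 'f) trm list"
  | Abs 'a "('a, 'v, 'f) trm"

definition comm_signature :: "('f \<Rightarrow> nat) \<Rightarrow> ('f \<Rightarrow> bool) \<Rightarrow> bool" where
  "comm_signature ar C \<longleftrightarrow> (\<forall>f. C f \<longrightarrow> ar f = 2)"

primrec wf_trm :: "('f \<Rightarrow> nat) \<Rightarrow> ('a, 'v, 'f) trm \<Rightarrow> bool" where
  "wf_trm ar (Atom a) = True"
| "wf_trm ar (Susp \<pi> X) = True"
| "wf_trm ar (App f ts) = (length ts = ar f \<and> list_all (wf_trm ar) ts)"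
| "wf_trm ar (Abs a t) = wf_trm ar t"

primrec atoms_trm :: "('a, 'v, 'f) trm \<Rightarrow> 'a set" where
  "atoms_trm (Atom a) = {a}"
| "atoms_trm (Susp \<pi> X) = affected \<pi>"
| "atoms_trm (App f ts) = \<Union> (set (map atoms_trm ts))"
| "atoms_trm (Abs a t) = insert a (atoms_trm t)"

primrec perm_trm :: "'a perm \<Rightarrow> ('a, 'v, 'f) trm \<Rightarrow> ('a, 'v, 'f) trm" where
  "perm_trm \<pi> (Atom a) = Atom (\<pi> \<langle>$\<rangle> a)"
| "perm_trm \<pi> (Susp \<pi>' X) = Susp (\<pi> * \<pi>') X"
| "perm_trm \<pi> (App f ts) = App f (map (perm_trm \<pi>) ts)"
| "perm_trm \<pi> (Abs a t) = Abs (\<pi> \<langle>$\<rangle> a) (perm_trm \<pi> t)"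


section \<open>Fixed-point contexts\<close>

text \<open>The pair \<open>(\<pi>, X)\<close> stands for the constraint \<open>\<pi> \<curlywedge> X\<close>.\<close>

type_synonym ('a, 'v) constraints = "('a perm \<times> 'v) set"

text \<open>
  In the first rule both parts are required to be nontrivial: otherwise the rule would merely add
  \<open>1 \<curlywedge> X\<close> to a constraint that is already split.
\<close>

inductive fp_step :: "'a list \<Rightarrow> ('a, 'v) constraints \<Rightarrow> ('a, 'v) constraints \<Rightarrow> bool"
  for cs :: "'a list" and \<Upsilon> :: "('a, 'v) constraints" where
  R1: "\<lbrakk>(\<pi>, X) \<in> \<Upsilon>; cycles_meeting cs \<pi> \<noteq> 1; cycles_avoiding cs \<pi> \<noteq> 1\<rbrakk>
    \<Longrightarrow> fp_step cs \<Upsilon> (\<Upsilon> - {(\<pi>, X)} \<union> {(cycles_meeting cs \<pi>, X), (cycles_avoiding cs \<pi>, X)})"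
| R2: "\<lbrakk>(\<pi>, X) \<in> \<Upsilon>; \<pi> = cycles_meeting cs \<pi>;
     (\<rho> * \<rho>', X) \<in> \<Upsilon>; cycles_meeting cs (\<rho> * \<rho>') = 1;
     is_cycle \<rho>; affected \<rho> \<inter> affected \<rho>' = {}; affected \<pi> \<inter> affected \<rho> \<noteq> {}\<rbrakk>
    \<Longrightarrow> fp_step cs \<Upsilon> (\<Upsilon> - {(\<pi>, X), (\<rho> * \<rho>', X)} \<union> {(\<pi> * \<rho>, X), (\<rho>', X)})"

definition fp_context :: "'a list \<Rightarrow> ('a, 'v) constraints \<Rightarrow> bool" where
  "fp_context cs \<Upsilon> \<longleftrightarrow> distinct cs \<and> finite \<Upsilon> \<and> (\<nexists>\<Upsilon>'. fp_step cs \<Upsilon> \<Upsilon>')"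

definition atoms_ctx :: "'a list \<Rightarrow> ('a, 'v) constraints \<Rightarrow> 'a set" where
  "atoms_ctx cs \<Upsilon> = set cs \<union> (\<Union>(\<pi>, X) \<in> \<Upsilon>. affected \<pi>)"

definition F_atoms :: "'a list \<Rightarrow> ('a, 'v) constraints \<Rightarrow> 'v \<Rightarrow> 'a set" where
  "F_atoms cs \<Upsilon> X = set cs \<union> \<Union> {affected \<pi> | \<pi>. (\<pi>, X) \<in> \<Upsilon> \<and> \<pi> = cycles_meeting cs \<pi>}"

definition P_perms :: "'a list \<Rightarrow> ('a, 'v) constraints \<Rightarrow> 'v \<Rightarrow> 'a perm set" where
  "P_perms cs \<Upsilon> X = {cycles_avoiding cs \<pi> | \<pi>. (\<pi>, X) \<in> \<Upsilon>}"

definition PN :: "'a list \<Rightarrow> ('a, 'v) constraints \<Rightarrow> 'v \<Rightarrow> 'a perm set" where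
  "PN cs \<Upsilon> X =
    {h * k | h k. h \<in> Perms_on (F_atoms cs \<Upsilon> X) \<and> k \<in> generate perm_group (P_perms cs \<Upsilon> X)}"


section \<open>Derivability\<close>

inductive derives ::
  "('f \<Rightarrow> bool) \<Rightarrow> ('a, 'v) constraints \<Rightarrow> 'a list \<Rightarrow> ('a, 'v, 'f) trm \<Rightarrow> ('a, 'v, 'f) trm \<Rightarrow> bool"
  for C :: "'f \<Rightarrow> bool" and \<Upsilon> :: "('a, 'v) constraints" where
  atom: "derives C \<Upsilon> cs (Atom a) (Atom a)"
| var: "inverse \<pi>' * \<pi> \<in> PN cs \<Upsilon> X \<Longrightarrow> derives C \<Upsilon> cs (Susp \<pi> X) (Susp \<pi>' X)"
| app: "\<lbrakk>\<not> C f; list_all2 (derives C \<Upsilon> cs) ts us\<rbrakk> \<Longrightarrow> derives C \<Upsilon> cs (App f ts) (App f us)"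
| comm: "\<lbrakk>C f; derives C \<Upsilon> cs s\<^sub>0 t\<^sub>0 \<and> derives C \<Upsilon> cs s\<^sub>1 t\<^sub>1
      \<or> derives C \<Upsilon> cs s\<^sub>0 t\<^sub>1 \<and> derives C \<Upsilon> cs s\<^sub>1 t\<^sub>0\<rbrakk>
    \<Longrightarrow> derives C \<Upsilon> cs (App f [s\<^sub>0, s\<^sub>1]) (App f [t\<^sub>0, t\<^sub>1])"
| abs_same: "derives C \<Upsilon> cs t t' \<Longrightarrow> derives C \<Upsilon> cs (Abs a t) (Abs a t')"
| abs_diff: "\<lbrakk>c\<^sub>1 \<notin> atoms_ctx cs \<Upsilon> \<union> {a, b} \<union> atoms_trm t \<union> atoms_trm s;
     derives C \<Upsilon> (cs @ [c\<^sub>1]) (perm_trm \<langle>a \<leftrightarrow> c\<^sub>1\<rangle> t) (perm_trm \<langle>b \<leftrightarrow> c\<^sub>1\<rangle> s)\<rbrakk>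
    \<Longrightarrow> derives C \<Upsilon> cs (Abs a t) (Abs b s)"


section \<open>Commutative nominal algebras\<close>

definition supports :: "('a perm \<Rightarrow> 'x \<Rightarrow> 'x) \<Rightarrow> 'a set \<Rightarrow> 'x \<Rightarrow> bool" where
  "supports act B x \<longleftrightarrow> (\<forall>\<pi>. (\<forall>a\<in>B. \<pi> \<langle>$\<rangle> a = a) \<longrightarrow> act \<pi> x = x)"

definition nominal_set :: "'x set \<Rightarrow> ('a perm \<Rightarrow> 'x \<Rightarrow> 'x) \<Rightarrow> bool" where
  "nominal_set S act \<longleftrightarrow>
    (\<forall>\<pi>. \<forall>x\<in>S. act \<pi> x \<in> S) \<and>
    (\<forall>x\<in>S. act 1 x = x) \<and>
    (\<forall>\<pi> \<pi>'. \<forall>x\<in>S. act (\<pi> * \<pi>') x = act \<pi> (act \<pi>' x)) \<and>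
    (\<forall>x\<in>S. \<exists>B. finite B \<and> supports act B x)"

record ('a, 'f, 'x) nom_alg =
  univ :: "'x set"
  act :: "'a perm \<Rightarrow> 'x \<Rightarrow> 'x"
  atm :: "'a \<Rightarrow> 'x"
  abst :: "'a \<Rightarrow> 'x \<Rightarrow> 'x"
  opn :: "'f \<Rightarrow> 'x list \<Rightarrow> 'x"

text \<open>
  \<open>\<forall>\<^sub>\<infinity>c. \<phi> c\<close> says that \<open>\<phi>\<close> holds for all but finitely many \<open>c\<close>; this is the quantifier \<open>\<^bold>N\<close>.
\<close>

definition comm_nom_alg ::
  "('f \<Rightarrow> nat) \<Rightarrow> ('f \<Rightarrow> bool) \<Rightarrow> ('a, 'f, 'x) nom_alg \<Rightarrow> bool" where
  "comm_nom_alg ar C A \<longleftrightarrow>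
    nominal_set (univ A) (act A) \<and>
    range (atm A) \<subseteq> univ A \<and> inj (atm A) \<and>
    (\<forall>\<pi> a. act A \<pi> (atm A a) = atm A (\<pi> \<langle>$\<rangle> a)) \<and>
    (\<forall>a. \<forall>x\<in>univ A. abst A a x \<in> univ A) \<and>
    (\<forall>\<pi> a. \<forall>x\<in>univ A. act A \<pi> (abst A a x) = abst A (\<pi> \<langle>$\<rangle> a) (act A \<pi> x)) \<and>
    (\<forall>a. \<forall>x\<in>univ A. \<forall>\<^sub>\<infinity>c. act A \<langle>a \<leftrightarrow> c\<rangle> (abst A a x) = abst A a x) \<and>
    (\<forall>f xs. length xs = ar f \<and> set xs \<subseteq> univ A \<longrightarrow> opn A f xs \<in> univ A) \<and>
    (\<forall>\<pi> f xs. length xs = ar f \<and> set xs \<subseteq> univ A \<longrightarrow>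
      act A \<pi> (opn A f xs) = opn A f (map (act A \<pi>) xs)) \<and>
    (\<forall>f. C f \<longrightarrow> (\<forall>x\<in>univ A. \<forall>y\<in>univ A. opn A f [x, y] = opn A f [y, x]))"

primrec interp ::
  "('a, 'f, 'x) nom_alg \<Rightarrow> ('v \<Rightarrow> 'x) \<Rightarrow> ('a, 'v, 'f) trm \<Rightarrow> 'x" where
  "interp A \<sigma> (Atom a) = atm A a"
| "interp A \<sigma> (Susp \<pi> X) = act A \<pi> (\<sigma> X)"
| "interp A \<sigma> (App f ts) = opn A f (map (interp A \<sigma>) ts)"
| "interp A \<sigma> (Abs a t) = abst A a (interp A \<sigma> t)"


section \<open>Validity\<close>

primrec new_quant :: "nat \<Rightarrow> ('a list \<Rightarrow> bool) \<Rightarrow> bool" where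
  "new_quant 0 \<phi> = \<phi> []"
| "new_quant (Suc n) \<phi> = (\<forall>\<^sub>\<infinity>d. new_quant n (\<lambda>ds. \<phi> (d # ds)))"

text \<open>
  The names \<open>cs\<close> of a context are bound by \<open>\<^bold>N\<close>, so \<open>\<^bold>N cs. \<phi>(cs)\<close> is \<open>new_quant\<close> applied to
  \<open>\<lambda>ds. \<phi>(ds)\<close>, where \<open>\<phi>(ds)\<close> replaces \<open>cs\<close> by \<open>ds\<close> in the syntax.  As \<open>new_quant\<close> only looks at
  distinct \<open>ds\<close> that are fresh for any prescribed finite set of atoms, the replacement can be
  carried out by the permutation \<open>swaps cs ds\<close>.  Replacing atoms inside a suspended permutation is
  conjugation, so \<open>rename_trm\<close> differs from \<open>perm_trm\<close> on suspensions.
\<close>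

fun swaps :: "'a list \<Rightarrow> 'a list \<Rightarrow> 'a perm" where
  "swaps (c # cs) (d # ds) = \<langle>c \<leftrightarrow> d\<rangle> * swaps cs ds"
| "swaps _ _ = 1"

definition rename_perm :: "'a perm \<Rightarrow> 'a perm \<Rightarrow> 'a perm" where
  "rename_perm \<rho> \<pi> = \<rho> * \<pi> * inverse \<rho>"

primrec rename_trm :: "'a perm \<Rightarrow> ('a, 'v, 'f) trm \<Rightarrow> ('a, 'v, 'f) trm" where
  "rename_trm \<rho> (Atom a) = Atom (\<rho> \<langle>$\<rangle> a)"
| "rename_trm \<rho> (Susp \<pi> X) = Susp (rename_perm \<rho> \<pi>) X"
| "rename_trm \<rho> (App f ts) = App f (map (rename_trm \<rho>) ts)"
| "rename_trm \<rho> (Abs a t) = Abs (\<rho> \<langle>$\<rangle> a) (rename_trm \<rho> t)"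

definition context_valid ::
  "('a, 'f, 'x) nom_alg \<Rightarrow> ('v \<Rightarrow> 'x) \<Rightarrow> 'a list \<Rightarrow> ('a, 'v) constraints \<Rightarrow> bool" where
  "context_valid A \<sigma> cs \<Upsilon> \<longleftrightarrow>
    (\<forall>(\<pi>, X) \<in> \<Upsilon>. new_quant (length cs) (\<lambda>ds. act A (rename_perm (swaps cs ds) \<pi>) (\<sigma> X) = \<sigma> X))"

text \<open>
  The names \<open>cs\<close> may also occur in \<open>t\<close> and \<open>u\<close>, where they are bound as well.  If they do not
  occur there, the conclusion is just \<open>interp A \<sigma> t = interp A \<sigma> u\<close>; see \<open>judgement_valid_iff\<close>.
  The binding cannot be dropped in general: with \<open>cs = [a, b]\<close> and no constraints,
  \<open>Susp \<langle>a \<leftrightarrow> b\<rangle> X\<close> and \<open>Susp 1 X\<close> are derivably equal, but a valuation sending \<open>X\<close> to the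
  interpretation of \<open>a\<close> separates them.
\<close>

definition judgement_valid ::
  "('a, 'f, 'x) nom_alg \<Rightarrow> ('v \<Rightarrow> 'x) \<Rightarrow> 'a list \<Rightarrow> ('a, 'v) constraints \<Rightarrow>
    ('a, 'v, 'f) trm \<Rightarrow> ('a, 'v, 'f) trm \<Rightarrow> bool" where
  "judgement_valid A \<sigma> cs \<Upsilon> t u \<longleftrightarrow>
    (context_valid A \<sigma> cs \<Upsilon> \<longrightarrow>
      new_quant (length cs) (\<lambda>ds.
        interp A \<sigma> (rename_trm (swaps cs ds) t) = interp A \<sigma> (rename_trm (swaps cs ds) u)))"

text \<open>\<open>entails TYPE('x)\<close> is semantic consequence over all algebras whose carrier is a set in \<open>'x\<close>.
  HOL cannot quantify over \<open>'x\<close> inside a formula.  Consequence over \<open>('a, 'v, 'f) trm set\<close> already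
  amounts to consequence over all algebras: whether a judgement is valid in an algebra under a
  valuation depends only on the subalgebra generated by the values of the valuation, whose elements
  are interpretations of terms, so that it has an isomorphic copy made of sets of terms.
\<close>

definition entails ::
  "'x itself \<Rightarrow> ('f \<Rightarrow> nat) \<Rightarrow> ('f \<Rightarrow> bool) \<Rightarrow> ('a, 'v) constraints \<Rightarrow> 'a list \<Rightarrow>
    ('a, 'v, 'f) trm \<Rightarrow> ('a, 'v, 'f) trm \<Rightarrow> bool" where
  "entails _ ar C \<Upsilon> cs t u \<longleftrightarrow>
    (\<forall>(A :: ('a, 'f, 'x) nom_alg) \<sigma>.
      comm_nom_alg ar C A \<and> range \<sigma> \<subseteq> univ A \<longrightarrow> judgement_valid A \<sigma> cs \<Upsilon> t u)"

lemma finite_atoms_trm: "finite (atoms_trm t)"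
  by (induction t) auto

lemma affected_swaps: "affected (swaps cs ds) \<subseteq> set cs \<union> set ds"
proof (induction cs ds rule: swaps.induct)
  case (1 c cs d ds)
  have "affected \<langle>c \<leftrightarrow> d\<rangle> \<subseteq> {c, d}"
    by (cases "c = d") (auto simp: affected_swap)
  then show ?case
    using 1 affected_times[of "\<langle>c \<leftrightarrow> d\<rangle>" "swaps cs ds"] by fastforce
qed auto

lemma rename_trm_id:
  "affected \<rho> \<inter> atoms_trm t = {} \<Longrightarrow> rename_trm \<rho> t = t"
proof (induction t)
  case (Susp \<pi> X)
  then have "\<rho> * \<pi> = \<pi> * \<rho>"
    by (intro perm_mult_commute) auto
  then show ?case
    by (simp add: rename_perm_def mult.assoc)
next
  case (App f ts)
  then show ?case
    by (auto intro!: map_idI)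
qed (auto simp: in_affected)

lemma new_quant_const:
  assumes inf: "infinite (UNIV :: 'a set)" and B: "finite B"
    and "\<And>ds. set ds \<inter> B = {} \<Longrightarrow> \<phi> ds \<longleftrightarrow> Q"
  shows "new_quant n (\<phi> :: 'a list \<Rightarrow> bool) \<longleftrightarrow> Q"
  using assms(3)
proof (induction n arbitrary: \<phi>)
  case (Suc n)
  have "new_quant n (\<lambda>ds. \<phi> (d # ds)) \<longleftrightarrow> Q" if "d \<notin> B" for d
    using Suc.prems that by (intro Suc.IH) auto
  moreover have "\<forall>\<^sub>\<infinity>d. d \<notin> B"
    using B by (simp add: eventually_cofinite)
  ultimately have "(\<forall>\<^sub>\<infinity>d. new_quant n (\<lambda>ds. \<phi> (d # ds))) \<longleftrightarrow> (\<forall>\<^sub>\<infinity>d::'a. Q)"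
    by (intro eventually_cong[OF \<open>\<forall>\<^sub>\<infinity>d. d \<notin> B\<close>]) auto
  also have "\<dots> \<longleftrightarrow> Q"
    using inf by (cases Q) (auto simp: eventually_cofinite)
  finally show ?case by simp
qed auto

lemma judgement_valid_iff:
  fixes A :: "('a, 'f, 'x) nom_alg"
  assumes "infinite (UNIV :: 'a set)" and "set cs \<inter> (atoms_trm t \<union> atoms_trm u) = {}"
  shows "judgement_valid A \<sigma> cs \<Upsilon> t u \<longleftrightarrow>
    (context_valid A \<sigma> cs \<Upsilon> \<longrightarrow> interp A \<sigma> t = interp A \<sigma> u)"
proof -
  have "new_quant (length cs) (\<lambda>ds.
      interp A \<sigma> (rename_trm (swaps cs ds) t) = interp A \<sigma> (rename_trm (swaps cs ds) u)) \<longleftrightarrow>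
    interp A \<sigma> t = interp A \<sigma> u"
  proof (rule new_quant_const[OF assms(1), where B = "atoms_trm t \<union> atoms_trm u"])
    fix ds :: "'a list"
    assume "set ds \<inter> (atoms_trm t \<union> atoms_trm u) = {}"
    then have "affected (swaps cs ds) \<inter> atoms_trm t = {}" "affected (swaps cs ds) \<inter> atoms_trm u = {}"
      using assms(2) affected_swaps[of cs ds] by blast+
    then show "interp A \<sigma> (rename_trm (swaps cs ds) t) = interp A \<sigma> (rename_trm (swaps cs ds) u) \<longleftrightarrow>
        interp A \<sigma> t = interp A \<sigma> u"
      by (simp add: rename_trm_id)
  qed (auto simp: finite_atoms_trm)
  then show ?thesis
    by (simp add: judgement_valid_def)
qed

end

theory Submission
  imports Defs
begin

text \<open>
  Soundness: if a constraint of the context that meets the quantified names holds for fresh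
  instances of these names, then every atom of \<open>F_atoms cs \<Upsilon> X\<close> outside \<open>cs\<close> is fresh for the value
  of \<open>X\<close>. Once \<open>cs\<close> is renamed to fresh names, all of \<open>PN cs \<Upsilon> X\<close> fixes this value.

  Completeness: let \<open>D\<close> be the finite set of all atoms of the judgement. In normal form the
  permutations in \<open>P_perms cs \<Upsilon> X\<close> act on \<open>S = D - F_atoms cs \<Upsilon> X\<close>. Let \<open>G X\<close> be the group of those
  permutations that agree on \<open>S\<close> with an element of \<open>\<langle>P_perms cs \<Upsilon> X\<rangle>\<close>. Unlike \<open>PN cs \<Upsilon> X\<close> it
  contains all permutations away from a finite set, so terms modulo derivability with \<open>G\<close> in place
  of \<open>PN\<close> form a nominal algebra, and it satisfies the context. For permutations
  of \<open>D\<close> and the names added to \<open>cs\<close> in a derivation, membership in \<open>G X\<close> implies membership in \<open>PN\<close>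
  for the extended list of names, so an equation that holds in this
  algebra is derivable.
\<close>

section \<open>Permutations\<close>

lemma apply_mult [simp]: "(f * g) \<langle>$\<rangle> a = f \<langle>$\<rangle> (g \<langle>$\<rangle> a)"
  by (simp add: apply_times)

lemma apply_inverse_cancel [simp]:
  "f \<langle>$\<rangle> (inverse f \<langle>$\<rangle> a) = a" "inverse f \<langle>$\<rangle> (f \<langle>$\<rangle> a) = a"
  by (simp_all flip: apply_mult)

lemma perm_mult_inverse_cancel [simp]:
  fixes f g :: "'a perm"
  shows "f * (inverse f * g) = g" "inverse f * (f * g) = g"
  by (simp_all flip: mult.assoc)

lemma apply_outside_affected: "a \<notin> affected f \<Longrightarrow> f \<langle>$\<rangle> a = a"
  by (simp add: in_affected)

lemma apply_in_superset_affected: "affected f \<subseteq> B \<Longrightarrow> a \<in> B \<Longrightarrow> f \<langle>$\<rangle> a \<in> B"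
  by (metis apply_affected apply_outside_affected subsetD)

lemma affected_swap_subset: "affected \<langle>a \<leftrightarrow> b\<rangle> \<subseteq> {a, b}"
  by (cases "a = b") (simp_all add: affected_swap)

section \<open>Conjugation of permutations\<close>

lemma rename_perm_swap: "rename_perm \<rho> \<langle>a \<leftrightarrow> b\<rangle> = \<langle>\<rho> \<langle>$\<rangle> a \<leftrightarrow> \<rho> \<langle>$\<rangle> b\<rangle>"
proof (rule perm_eqI)
  fix x
  consider "x = \<rho> \<langle>$\<rangle> a" | "x = \<rho> \<langle>$\<rangle> b" | "inverse \<rho> \<langle>$\<rangle> x \<noteq> a" "inverse \<rho> \<langle>$\<rangle> x \<noteq> b"
    by (metis apply_inverse_cancel(1))
  then show "rename_perm \<rho> \<langle>a \<leftrightarrow> b\<rangle> \<langle>$\<rangle> x = \<langle>\<rho> \<langle>$\<rangle> a \<leftrightarrow> \<rho> \<langle>$\<rangle> b\<rangle> \<langle>$\<rangle> x"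
  proof cases
    case 3
    then have "x \<noteq> \<rho> \<langle>$\<rangle> a" "x \<noteq> \<rho> \<langle>$\<rangle> b"
      by auto
    with 3 show ?thesis
      by (simp add: rename_perm_def)
  qed (simp_all add: rename_perm_def)
qed

lemma rename_perm_times: "rename_perm \<rho> (f * g) = rename_perm \<rho> f * rename_perm \<rho> g"
  by (simp add: rename_perm_def mult.assoc)

lemma rename_perm_inverse: "rename_perm \<rho> (inverse f) = inverse (rename_perm \<rho> f)"
  by (simp add: rename_perm_def mult.assoc)

lemma rename_perm_one [simp]: "rename_perm \<rho> 1 = 1"
  by (simp add: rename_perm_def)

lemma rename_perm_by_times: "rename_perm (\<rho> * \<rho>') f = rename_perm \<rho> (rename_perm \<rho>' f)"
  by (simp add: rename_perm_def mult.assoc)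

lemma rename_perm_power: "rename_perm \<rho> f ^ n = rename_perm \<rho> (f ^ n)"
  by (induction n) (simp_all add: rename_perm_times)

lemma rename_perm_id: "affected \<rho> \<inter> affected f = {} \<Longrightarrow> rename_perm \<rho> f = f"
  using perm_mult_commute[of f \<rho>] by (simp add: rename_perm_def Int_commute mult.assoc[of f])

lemma affected_rename_perm: "affected (rename_perm \<rho> f) = (\<langle>$\<rangle>) \<rho> ` affected f"
proof (intro equalityI subsetI)
  fix a assume "a \<in> affected (rename_perm \<rho> f)"
  then have "inverse \<rho> \<langle>$\<rangle> a \<in> affected f"
    by (auto simp: in_affected rename_perm_def)
  then show "a \<in> (\<langle>$\<rangle>) \<rho> ` affected f"
    by (intro image_eqI) auto
qed (auto simp: in_affected rename_perm_def apply_inj)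

text \<open>Disjointness and distinctness keep the swappings from interfering: the image of an atom
  under one of them is not moved again by another.\<close>

lemma swaps_in:
  assumes "distinct cs" "distinct ds" "length cs = length ds" "set cs \<inter> set ds = {}" "a \<in> set cs"
  shows "swaps cs ds \<langle>$\<rangle> a \<in> set ds"
  using assms
proof (induction cs ds rule: swaps.induct)
  case (1 c cs d ds)
  show ?case
  proof (cases "a = c")
    case True
    with 1 have "swaps cs ds \<langle>$\<rangle> a = a"
      using affected_swaps[of cs ds] by (intro apply_outside_affected) auto
    with True show ?thesis by simp
  next
    case False
    with 1 have "swaps cs ds \<langle>$\<rangle> a \<in> set ds"
      by auto
    moreover from this have "swaps cs ds \<langle>$\<rangle> a \<noteq> c" "swaps cs ds \<langle>$\<rangle> a \<noteq> d"
      using 1 by auto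
    ultimately show ?thesis
      by simp
  qed
qed auto

lemma swaps_outside: "a \<notin> set cs \<Longrightarrow> a \<notin> set ds \<Longrightarrow> swaps cs ds \<langle>$\<rangle> a = a"
  using affected_swaps[of cs ds] by (intro apply_outside_affected) auto

section \<open>Products of cycles of a permutation\<close>

lemma cycles_meeting_times_avoiding: "cycles_meeting cs \<pi> * cycles_avoiding cs \<pi> = \<pi>"
  by (rule perm_eqI) (auto simp: apply_cycles_meeting apply_cycles_avoiding)

lemma affected_cycles_avoiding: "affected (cycles_avoiding cs \<pi>) \<subseteq> affected \<pi> - set cs"
proof
  fix a assume "a \<in> affected (cycles_avoiding cs \<pi>)"
  then have "Perm.orbit \<pi> a \<inter> set cs = {}" "\<pi> \<langle>$\<rangle> a \<noteq> a"
    by (auto simp: in_affected apply_cycles_avoiding split: if_splits)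
  then show "a \<in> affected \<pi> - set cs"
    unfolding Diff_iff in_affected using in_orbit_self[of a \<pi>] by blast
qed

lemma apply_power_cong_orbit:
  assumes "\<And>b. b \<in> Perm.orbit f a \<Longrightarrow> g \<langle>$\<rangle> b = f \<langle>$\<rangle> b"
  shows "(g ^ n) \<langle>$\<rangle> a = (f ^ n) \<langle>$\<rangle> a"
  using assms by (induction n) simp_all

text \<open>The singleton list \<open>[a]\<close> selects the cycle of \<open>\<pi>\<close> through
  \<open>a\<close>. This is the cycle to be split off when \<open>R2\<close> is applied in
  \<open>affected_P_perms\<close>.\<close>

lemma is_cycle_cycles_meeting:
  assumes "a \<in> affected \<pi>"
  shows "is_cycle (cycles_meeting [a] \<pi>)"
proof -
  let ?\<rho> = "cycles_meeting [a] \<pi>"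
  have \<rho>_apply: "?\<rho> \<langle>$\<rangle> b = \<pi> \<langle>$\<rangle> b" if "b \<in> Perm.orbit \<pi> a" for b
    using that orbit_equiv[of b \<pi> a] by (simp add: apply_cycles_meeting)
  have "(?\<rho> ^ n) \<langle>$\<rangle> a = (\<pi> ^ n) \<langle>$\<rangle> a" for n
    by (rule apply_power_cong_orbit) (rule \<rho>_apply)
  then have orbit: "Perm.orbit ?\<rho> a = Perm.orbit \<pi> a"
    by (simp add: Perm.orbit_def)
  have "affected ?\<rho> = Perm.orbit \<pi> a"
  proof (intro equalityI subsetI)
    fix b assume "b \<in> affected ?\<rho>"
    then have "a \<in> Perm.orbit \<pi> b"
      by (auto simp: in_affected apply_cycles_meeting split: if_splits)
    then have "Perm.orbit \<pi> a = Perm.orbit \<pi> b"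
      by (rule orbit_equiv)
    then show "b \<in> Perm.orbit \<pi> a"
      by simp
  next
    fix b assume "b \<in> Perm.orbit \<pi> a"
    moreover from this have "b \<in> affected \<pi>"
      using orbit_subset_eq_affected[OF assms] by auto
    ultimately show "b \<in> affected ?\<rho>"
      by (simp add: in_affected \<rho>_apply)
  qed
  moreover have "a \<in> Perm.orbit \<pi> a"
    by simp
  ultimately show ?thesis
    unfolding is_cycle_def using orbit by auto
qed


section \<open>The new-name quantifier\<close>

text \<open>With \<open>new_quantE\<close> this gives the some/any reading of the quantifier: prove
  a property for all sufficiently fresh tuples, use it at one tuple as fresh as required. In the
  induction \<open>B\<close> grows by each chosen name, which makes the names distinct.\<close>

lemma new_quantI:
  assumes "finite B"
    and "\<And>ds. length ds = n \<Longrightarrow> distinct ds \<Longrightarrow> set ds \<inter> B = {} \<Longrightarrow> \<phi> ds"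
  shows "new_quant n \<phi>"
  using assms
proof (induction n arbitrary: \<phi> B)
  case (Suc n)
  have "new_quant n (\<lambda>ds. \<phi> (d # ds))" if "d \<notin> B" for d
    using Suc.prems that by (intro Suc.IH[of "insert d B"]) auto
  then have "{d. \<not> new_quant n (\<lambda>ds. \<phi> (d # ds))} \<subseteq> B"
    by auto
  then show ?case
    using Suc.prems(1) by (auto simp: eventually_cofinite intro: finite_subset)
qed simp

lemma new_quantE:
  fixes B :: "'a set"
  assumes "infinite (UNIV :: 'a set)" "finite B" "new_quant n \<phi>"
  obtains ds where "length ds = n" "distinct ds" "set ds \<inter> B = {}" "\<phi> ds"
proof -
  have "\<exists>ds. length ds = n \<and> distinct ds \<and> set ds \<inter> B = {} \<and> \<phi> ds"
    using assms(2,3)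
  proof (induction n arbitrary: \<phi> B)
    case (Suc n)
    then have "finite ({d. \<not> new_quant n (\<lambda>ds. \<phi> (d # ds))} \<union> B)"
      by (simp add: eventually_cofinite)
    then obtain d where d: "new_quant n (\<lambda>ds. \<phi> (d # ds))" "d \<notin> B"
      using ex_new_if_finite[OF assms(1)] by blast
    with Suc.IH[OF _ d(1), of "insert d B"] Suc.prems(1) obtain ds where
      "length ds = n \<and> distinct ds \<and> set ds \<inter> insert d B = {} \<and> \<phi> (d # ds)"
      by auto
    with d(2) show ?case
      by (intro exI[of _ "d # ds"]) auto
  qed simp
  with that show thesis by blast
qed


section \<open>Finite supports\<close>

lemma supportsD: "supports pact B x \<Longrightarrow> affected \<pi> \<inter> B = {} \<Longrightarrow> pact \<pi> x = x"
  unfolding supports_def by (metis apply_outside_affected disjoint_iff)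

lemma nominal_setD:
  assumes "nominal_set S pact" "x \<in> S"
  shows "pact \<pi> x \<in> S" "pact 1 x = x" "pact (\<pi> * \<pi>') x = pact \<pi> (pact \<pi>' x)"
    "\<exists>B. finite B \<and> supports pact B x"
  using assms by (simp_all add: nominal_set_def)

lemma act_inverse_eq:
  assumes "nominal_set S pact" "x \<in> S" "pact \<pi> x = x"
  shows "pact (inverse \<pi>) x = x"
  using nominal_setD(2,3)[OF assms(1,2)] assms(3) by (metis perm.left_inverse)

lemma act_power_eq:
  assumes "nominal_set S pact" "x \<in> S" "pact \<pi> x = x"
  shows "pact (\<pi> ^ n) x = x"
  by (induction n) (simp_all add: nominal_setD(2,3)[OF assms(1,2)] assms(3))

text \<open>Conjugating by a permutation that fixes \<open>B\<close> and moves all other atoms of \<open>\<pi>\<close> out of \<open>B'\<close>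
  turns a permutation fixing \<open>B \<inter> B'\<close> into one fixing \<open>B'\<close>.\<close>

lemma supports_Int:
  fixes pact :: "'a perm \<Rightarrow> 'x \<Rightarrow> 'x"
  assumes inf: "infinite (UNIV :: 'a set)" and nom: "nominal_set S pact" "x \<in> S"
    and fin: "finite B" "finite B'" and supp: "supports pact B x" "supports pact B' x"
  shows "supports pact (B \<inter> B') x"
  unfolding supports_def
proof (intro allI impI)
  fix \<pi> :: "'a perm" assume fixed: "\<forall>a\<in>B \<inter> B'. \<pi> \<langle>$\<rangle> a = a"
  obtain es where es: "set es = affected \<pi> - B" "distinct es"
    using finite_distinct_list[of "affected \<pi> - B"] by auto
  have "new_quant (length es) (\<lambda>_. True)"
    by (rule new_quantI[of "{}"]) auto
  then obtain fs where fs: "length fs = length es" "distinct fs"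
      "set fs \<inter> (affected \<pi> \<union> B \<union> B') = {}"
    using new_quantE[OF inf, of "affected \<pi> \<union> B \<union> B'"] fin by (metis finite_Un finite_affected)
  let ?\<tau> = "swaps es fs"
  have \<tau>B: "?\<tau> \<langle>$\<rangle> a = a" if "a \<in> B" for a
    using es fs that by (intro swaps_outside) auto
  then have "pact ?\<tau> x = x"
    using supp(1) by (simp add: supports_def)
  \<comment> \<open>An atom of \<open>B\<close> moved by \<open>\<pi>\<close> is not in
    \<open>B'\<close>, because \<open>\<pi>\<close> fixes the intersection, and
    \<open>?\<tau>\<close> leaves it alone; the other moved atoms go to fresh names.\<close>
  have "?\<tau> \<langle>$\<rangle> a \<notin> B'" if "a \<in> affected \<pi>" for a
  proof (cases "a \<in> B")
    case True
    with that fixed \<tau>B show ?thesis by (auto simp: in_affected)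
  next
    case False
    with that es fs have "?\<tau> \<langle>$\<rangle> a \<in> set fs"
      by (intro swaps_in) auto
    with fs show ?thesis by auto
  qed
  then have "affected (rename_perm ?\<tau> \<pi>) \<inter> B' = {}"
    by (auto simp: affected_rename_perm)
  then have "pact (rename_perm ?\<tau> \<pi>) x = x"
    using supp(2) by (rule supportsD[rotated])
  moreover have "\<pi> = inverse ?\<tau> * (rename_perm ?\<tau> \<pi> * ?\<tau>)"
    by (simp add: rename_perm_def mult.assoc)
  ultimately show "pact \<pi> x = x"
    using nominal_setD(3)[OF nom] act_inverse_eq[OF nom \<open>pact ?\<tau> x = x\<close>] \<open>pact ?\<tau> x = x\<close>
    by metis
qed

text \<open>Supports that avoid the atoms of \<open>E\<close> one at a time are intersected.
  Freshness is thus handled without the least support: an atom is fresh if some finite support omits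
  it.\<close>

lemma supports_avoiding:
  fixes pact :: "'a perm \<Rightarrow> 'x \<Rightarrow> 'x"
  assumes inf: "infinite (UNIV :: 'a set)" and nom: "nominal_set S pact" "x \<in> S"
    and "finite E" and "\<And>a. a \<in> E \<Longrightarrow> \<exists>B. finite B \<and> a \<notin> B \<and> supports pact B x"
  shows "\<exists>B. finite B \<and> B \<inter> E = {} \<and> supports pact B x"
  using assms(4,5)
proof (induction E)
  case empty
  then show ?case using nominal_setD(4)[OF nom] by auto
next
  case (insert a E)
  then obtain B B' where "finite B" "B \<inter> E = {}" "supports pact B x"
      "finite B'" "a \<notin> B'" "supports pact B' x"
    by (metis insertCI)
  then show ?case
    using supports_Int[OF inf nom] by (intro exI[of _ "B \<inter> B'"]) auto
qed

lemma supports_image: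
  assumes nom: "nominal_set S pact" "x \<in> S" and "supports pact B x" "pact \<pi> x = x"
  shows "supports pact ((\<langle>$\<rangle>) \<pi> ` B) x"
  unfolding supports_def
proof (intro allI impI)
  fix \<tau> assume fixed: "\<forall>a\<in>(\<langle>$\<rangle>) \<pi> ` B. \<tau> \<langle>$\<rangle> a = a"
  then have "pact (inverse \<pi> * \<tau> * \<pi>) x = x"
    using assms(3) by (simp add: supports_def)
  moreover have "\<tau> = \<pi> * ((inverse \<pi> * \<tau> * \<pi>) * inverse \<pi>)"
    by (simp add: mult.assoc)
  ultimately show "pact \<tau> x = x"
    using nominal_setD(3)[OF nom] act_inverse_eq[OF nom assms(4)] assms(4) by metis
qed


section \<open>Fixed-point contexts in normal form\<close>

text \<open>If both parts were nontrivial, \<open>R1\<close> would apply. The identity falls under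
  both alternatives.\<close>

lemma fp_context_split:
  assumes "fp_context cs \<Upsilon>" "(\<pi>, X) \<in> \<Upsilon>"
  shows "\<pi> = cycles_meeting cs \<pi> \<and> cycles_avoiding cs \<pi> = 1 \<or>
    \<pi> = cycles_avoiding cs \<pi> \<and> cycles_meeting cs \<pi> = 1"
  using assms cycles_meeting_times_avoiding[of cs \<pi>] R1[of \<pi> X \<Upsilon> cs]
  by (metis fp_context_def mult.left_neutral mult.right_neutral)

lemma finite_atoms_ctx: "fp_context cs \<Upsilon> \<Longrightarrow> finite (atoms_ctx cs \<Upsilon>)"
  by (auto simp: fp_context_def atoms_ctx_def)

lemma F_atoms_subset: "F_atoms cs \<Upsilon> X \<subseteq> atoms_ctx cs \<Upsilon>"
  by (auto simp: F_atoms_def atoms_ctx_def)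

lemma affected_subset_atoms_ctx: "(\<pi>, X) \<in> \<Upsilon> \<Longrightarrow> affected \<pi> \<subseteq> atoms_ctx cs \<Upsilon>"
  by (auto simp: atoms_ctx_def)

text \<open>This is where normal form under \<open>R2\<close> matters. An atom \<open>a\<close>
  moved both by a constraint meeting \<open>cs\<close> and by one avoiding \<open>cs\<close> would
  let the rule shift the cycle through \<open>a\<close> from the latter to the former. Hence the two
  factors of \<open>PN\<close> act on disjoint sets of atoms.\<close>

lemma affected_P_perms:
  assumes ctx: "fp_context cs \<Upsilon>" and "k \<in> P_perms cs \<Upsilon> X"
  shows "affected k \<subseteq> atoms_ctx cs \<Upsilon> - F_atoms cs \<Upsilon> X"
proof -
  from assms(2) obtain \<tau> where \<tau>: "(\<tau>, X) \<in> \<Upsilon>" "k = cycles_avoiding cs \<tau>"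
    by (auto simp: P_perms_def)
  have sub: "affected k \<subseteq> affected \<tau> - set cs"
    unfolding \<tau>(2) by (rule affected_cycles_avoiding)
  have "a \<notin> affected k" if \<pi>: "(\<pi>, X) \<in> \<Upsilon>" "\<pi> = cycles_meeting cs \<pi>" "a \<in> affected \<pi>" for a \<pi>
  proof
    assume a: "a \<in> affected k"
    then have "k \<noteq> 1"
      by auto
    then have "cycles_meeting cs \<tau> = 1"
      using fp_context_split[OF ctx \<tau>(1)] \<tau>(2) by auto
    let ?\<rho> = "cycles_meeting [a] \<tau>" and ?\<rho>' = "cycles_avoiding [a] \<tau>"
    have "a \<in> affected \<tau>"
      using a sub by auto
    moreover have "affected ?\<rho> \<inter> affected ?\<rho>' = {}"
      by (auto simp: in_affected apply_cycles_meeting apply_cycles_avoiding split: if_splits)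
    moreover have "a \<in> affected ?\<rho>"
      using \<open>a \<in> affected \<tau>\<close> by (simp add: in_affected apply_cycles_meeting)
    ultimately have "fp_step cs \<Upsilon> (\<Upsilon> - {(\<pi>, X), (?\<rho> * ?\<rho>', X)} \<union> {(\<pi> * ?\<rho>, X), (?\<rho>', X)})"
      using \<pi> \<tau>(1) \<open>cycles_meeting cs \<tau> = 1\<close>
      by (intro R2) (auto simp: cycles_meeting_times_avoiding is_cycle_cycles_meeting)
    then show False
      using ctx by (auto simp: fp_context_def)
  qed
  then have "affected k \<inter> F_atoms cs \<Upsilon> X = {}"
    using sub by (auto simp: F_atoms_def)
  then show ?thesis
    using sub affected_subset_atoms_ctx[OF \<tau>(1)] by blast
qed

section \<open>Adding a fresh name to the quantified names\<close>

lemma orbit_Int_fresh: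
  assumes "c \<notin> affected \<pi>" "a \<in> affected \<pi>"
  shows "Perm.orbit \<pi> a \<inter> set (cs @ [c]) = Perm.orbit \<pi> a \<inter> set cs"
  using assms orbit_subset_eq_affected[OF assms(2)] by auto

lemma cycles_snoc_fresh:
  assumes "c \<notin> affected \<pi>"
  shows "cycles_meeting (cs @ [c]) \<pi> = cycles_meeting cs \<pi>"
    and "cycles_avoiding (cs @ [c]) \<pi> = cycles_avoiding cs \<pi>"
proof -
  have "cycles_meeting (cs @ [c]) \<pi> \<langle>$\<rangle> a = cycles_meeting cs \<pi> \<langle>$\<rangle> a \<and>
      cycles_avoiding (cs @ [c]) \<pi> \<langle>$\<rangle> a = cycles_avoiding cs \<pi> \<langle>$\<rangle> a" for a
  proof (cases "a \<in> affected \<pi>")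
    case True
    then show ?thesis
      by (simp only: apply_cycles_meeting apply_cycles_avoiding orbit_Int_fresh[OF assms] simp_thms)
  next
    \<comment> \<open>The orbit of \<open>a\<close> may be \<open>{c}\<close>, which meets only the
      longer list; the products of cycles fix \<open>a\<close> in either case.\<close>
    case False
    then show ?thesis
      by (simp add: apply_cycles_meeting apply_cycles_avoiding apply_outside_affected)
  qed
  then show "cycles_meeting (cs @ [c]) \<pi> = cycles_meeting cs \<pi>"
    and "cycles_avoiding (cs @ [c]) \<pi> = cycles_avoiding cs \<pi>"
    by (simp_all add: perm_eq_iff)
qed

text \<open>A fresh name lies on no nontrivial cycle of a constraint, so no constraint changes its
  kind. With \<open>P_perms_snoc_fresh\<close> this is the step under an abstraction in the
  inductions for soundness and completeness.\<close>

lemma F_atoms_snoc_fresh: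
  assumes "c \<notin> atoms_ctx cs \<Upsilon>"
  shows "F_atoms (cs @ [c]) \<Upsilon> X = insert c (F_atoms cs \<Upsilon> X)"
proof -
  have "c \<notin> affected \<pi>" if "(\<pi>, X) \<in> \<Upsilon>" for \<pi>
    using assms that by (auto simp: atoms_ctx_def)
  then have "{affected \<pi> |\<pi>. (\<pi>, X) \<in> \<Upsilon> \<and> \<pi> = cycles_meeting (cs @ [c]) \<pi>} =
      {affected \<pi> |\<pi>. (\<pi>, X) \<in> \<Upsilon> \<and> \<pi> = cycles_meeting cs \<pi>}"
    by (intro Collect_cong ex_cong1 conj_cong refl) (simp add: cycles_snoc_fresh(1))
  then show ?thesis
    by (simp add: F_atoms_def)
qed

lemma P_perms_snoc_fresh:
  assumes "c \<notin> atoms_ctx cs \<Upsilon>"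
  shows "P_perms (cs @ [c]) \<Upsilon> X = P_perms cs \<Upsilon> X"
proof -
  have "c \<notin> affected \<pi>" if "(\<pi>, X) \<in> \<Upsilon>" for \<pi>
    using assms that by (auto simp: atoms_ctx_def)
  then show ?thesis
    unfolding P_perms_def
    by (intro Collect_cong ex_cong1) (auto simp: cycles_snoc_fresh(2))
qed

section \<open>The group of permutations and its generated subgroups\<close>

lemma perm_group_simps [simp]:
  "carrier perm_group = UNIV" "mult perm_group = (*)" "one perm_group = 1"
  by (simp_all add: perm_group_def)

lemma inv_perm_group [simp]: "m_inv perm_group f = inverse f"
  by (rule group.inv_equality[OF group_perm_group]) simp_all

lemma generate_perm_group:
  assumes "K = generate perm_group P"
  shows "1 \<in> K" "k \<in> K \<Longrightarrow> inverse k \<in> K" "k \<in> K \<Longrightarrow> l \<in> K \<Longrightarrow> k * l \<in> K" "k \<in> P \<Longrightarrow> k \<in> K"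
proof -
  interpret subgroup K perm_group
    unfolding assms by (rule group.generate_is_subgroup[OF group_perm_group]) simp
  show "1 \<in> K" "k \<in> K \<Longrightarrow> inverse k \<in> K" "k \<in> K \<Longrightarrow> l \<in> K \<Longrightarrow> k * l \<in> K"
    using one_closed m_inv_closed m_closed by simp_all
  show "k \<in> P \<Longrightarrow> k \<in> K"
    unfolding assms by (rule generate.incl)
qed

lemma affected_generate:
  assumes "k \<in> generate perm_group P" "\<And>k. k \<in> P \<Longrightarrow> affected k \<subseteq> B"
  shows "affected k \<subseteq> B"
  using assms
proof (induction rule: generate.induct)
  case (eng h1 h2)
  then show ?case using affected_times[of h1 h2] by fastforce
qed auto


section \<open>Soundness\<close>

text \<open>The values of all variables together may have infinite support, so names are chosen
  fresh only for the values of the variables in the judgement.\<close>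

primrec vars_trm :: "('a, 'v, 'f) trm \<Rightarrow> 'v set" where
  "vars_trm (Atom a) = {}"
| "vars_trm (Susp \<pi> X) = {X}"
| "vars_trm (App f ts) = \<Union> (set (map vars_trm ts))"
| "vars_trm (Abs a t) = vars_trm t"

lemma finite_vars_trm: "finite (vars_trm t)"
  by (induction t) auto

lemma vars_perm_trm [simp]: "vars_trm (perm_trm \<pi> t) = vars_trm t"
  by (induction t) auto

lemma wf_perm_trm [simp]: "wf_trm ar (perm_trm \<pi> t) = wf_trm ar t"
  by (induction t) (auto simp: list_all_iff)

lemma wf_rename_trm [simp]: "wf_trm ar (rename_trm \<rho> t) = wf_trm ar t"
  by (induction t) (auto simp: list_all_iff)

lemma perm_trm_times: "perm_trm (\<pi> * \<pi>') t = perm_trm \<pi> (perm_trm \<pi>' t)"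
  by (induction t) (auto simp: mult.assoc)

lemma perm_trm_one [simp]: "perm_trm 1 t = t"
  by (induction t) (auto simp: map_idI)

lemma rename_trm_times: "rename_trm (\<rho> * \<rho>') t = rename_trm \<rho> (rename_trm \<rho>' t)"
  by (induction t) (auto simp: rename_perm_by_times)

lemma rename_perm_trm:
  "rename_trm \<rho> (perm_trm \<pi> t) = perm_trm (rename_perm \<rho> \<pi>) (rename_trm \<rho> t)"
  by (induction t) (auto simp: rename_perm_def mult.assoc)

section \<open>Interpretation in an algebra\<close>

lemma comm_nom_algD:
  assumes "comm_nom_alg ar C A"
  shows "nominal_set (univ A) (act A)" "atm A a \<in> univ A" "act A \<pi> (atm A a) = atm A (\<pi> \<langle>$\<rangle> a)"
    "x \<in> univ A \<Longrightarrow> abst A a x \<in> univ A"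
    "x \<in> univ A \<Longrightarrow> act A \<pi> (abst A a x) = abst A (\<pi> \<langle>$\<rangle> a) (act A \<pi> x)"
    "x \<in> univ A \<Longrightarrow> \<forall>\<^sub>\<infinity>c. act A \<langle>a \<leftrightarrow> c\<rangle> (abst A a x) = abst A a x"
    "length xs = ar f \<Longrightarrow> set xs \<subseteq> univ A \<Longrightarrow> opn A f xs \<in> univ A"
    "length xs = ar f \<Longrightarrow> set xs \<subseteq> univ A \<Longrightarrow> act A \<pi> (opn A f xs) = opn A f (map (act A \<pi>) xs)"
    "C f \<Longrightarrow> x \<in> univ A \<Longrightarrow> y \<in> univ A \<Longrightarrow> opn A f [x, y] = opn A f [y, x]"
  using assms unfolding comm_nom_alg_def by blast+

lemma interp_in_univ:
  assumes "comm_nom_alg ar C A" "range \<sigma> \<subseteq> univ A" "wf_trm ar t"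
  shows "interp A \<sigma> t \<in> univ A"
  using assms(3)
proof (induction t)
  case (Susp \<pi> X)
  have "\<sigma> X \<in> univ A"
    using assms(2) by blast
  then show ?case
    using nominal_setD(1)[OF comm_nom_algD(1)[OF assms(1)]] by simp
next
  case (App f ts)
  then show ?case
    by (auto simp: list_all_iff intro!: comm_nom_algD(7)[OF assms(1)])
qed (simp_all add: comm_nom_algD[OF assms(1)])

lemma interp_perm_trm:
  assumes "comm_nom_alg ar C A" "range \<sigma> \<subseteq> univ A" "wf_trm ar t"
  shows "interp A \<sigma> (perm_trm \<pi> t) = act A \<pi> (interp A \<sigma> t)"
  using assms(3)
proof (induction t)
  case (Susp \<pi>' X)
  have "\<sigma> X \<in> univ A"
    using assms(2) by blast
  then show ?case
    using nominal_setD(3)[OF comm_nom_algD(1)[OF assms(1)]] by simp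
next
  case (App f ts)
  then have "set (map (interp A \<sigma>) ts) \<subseteq> univ A"
    using interp_in_univ[OF assms(1,2)] by (auto simp: list_all_iff)
  moreover have "map (interp A \<sigma> \<circ> perm_trm \<pi>) ts = map (act A \<pi> \<circ> interp A \<sigma>) ts"
    using App by (auto simp: list_all_iff)
  ultimately show ?case
    using App.prems comm_nom_algD(8)[OF assms(1), of "map (interp A \<sigma>) ts" f]
    by (simp del: map_eq_conv)
qed (simp_all add: comm_nom_algD[OF assms(1)] interp_in_univ[OF assms(1,2)])

text \<open>Equivariance carries the swapping of the abstraction axiom inside, so the axiom becomes
  renaming of the bound name to all but finitely many atoms. \<open>L\<close> collects the
  exceptions.\<close>

lemma abst_fresh_eq:
  assumes "comm_nom_alg ar C A" "x \<in> univ A"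
  shows "\<exists>L. finite L \<and> (\<forall>d. d \<notin> L \<longrightarrow> abst A a x = abst A d (act A \<langle>a \<leftrightarrow> d\<rangle> x))"
  using comm_nom_algD(6)[OF assms, of a] comm_nom_algD(5)[OF assms]
  by (intro exI[of _ "{c. act A \<langle>a \<leftrightarrow> c\<rangle> (abst A a x) \<noteq> abst A a x}"])
    (auto simp: eventually_cofinite)

text \<open>\<open>\<tau>\<close> is a product of \<open>h\<close> and \<open>k\<close>. Conjugated
  by \<open>\<rho>\<close>, \<open>h\<close> moves only atoms outside the support \<open>B\<close>;
  the permutations whose conjugate fixes \<open>x\<close> form a group, which contains the
  generators of \<open>k\<close>.\<close>

lemma PN_fixes:
  assumes nom: "nominal_set S pact" "x \<in> S" and supp: "supports pact B x"
    and F: "\<And>a. a \<in> F_atoms cs \<Upsilon> X \<Longrightarrow> \<rho> \<langle>$\<rangle> a \<notin> B"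
    and P: "\<And>k. k \<in> P_perms cs \<Upsilon> X \<Longrightarrow> pact (rename_perm \<rho> k) x = x"
    and "\<tau> \<in> PN cs \<Upsilon> X"
  shows "pact (rename_perm \<rho> \<tau>) x = x"
proof -
  obtain h k where \<tau>: "\<tau> = h * k" and h: "affected h \<subseteq> F_atoms cs \<Upsilon> X"
      and k: "k \<in> generate perm_group (P_perms cs \<Upsilon> X)"
    using assms(6) by (auto simp: PN_def Perms_on_def)
  have "pact (rename_perm \<rho> h) x = x"
    using h F by (intro supportsD[OF supp]) (auto simp: affected_rename_perm)
  moreover have "pact (rename_perm \<rho> k) x = x"
    using k
  proof (induction rule: generate.induct)
    case (inv h)
    then show ?case
      using P act_inverse_eq[OF nom] by (simp add: rename_perm_inverse)
  qed (simp_all add: P rename_perm_times nominal_setD[OF nom])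
  ultimately show ?thesis
    by (simp add: \<tau> rename_perm_times nominal_setD[OF nom])
qed

text \<open>The permutation \<open>\<rho>\<close> moves the quantified names out of the supports of the values of the
  variables. It varies in the induction, since the name introduced by the second abstraction rule
  may well lie in one of these supports.\<close>

lemma derives_interp_eq:
  fixes A :: "('a, 'f, 'x) nom_alg"
  assumes inf: "infinite (UNIV :: 'a set)"
    and alg: "comm_nom_alg ar C A" and \<sigma>: "range \<sigma> \<subseteq> univ A"
    and fin: "finite \<Upsilon>" "finite V" "\<And>X. finite (B X)"
    and supp: "\<And>X. X \<in> V \<Longrightarrow> supports (act A) (B X) (\<sigma> X)"
    and "derives C \<Upsilon> cs t u" "wf_trm ar t" "wf_trm ar u" "vars_trm t \<subseteq> V" "vars_trm u \<subseteq> V"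
    and "\<And>X a. X \<in> V \<Longrightarrow> a \<in> F_atoms cs \<Upsilon> X \<Longrightarrow> \<rho> \<langle>$\<rangle> a \<notin> B X"
    and "\<And>X k. X \<in> V \<Longrightarrow> k \<in> P_perms cs \<Upsilon> X \<Longrightarrow> act A (rename_perm \<rho> k) (\<sigma> X) = \<sigma> X"
  shows "interp A \<sigma> (rename_trm \<rho> t) = interp A \<sigma> (rename_trm \<rho> u)"
  using assms(8-)
proof (induction arbitrary: \<rho> rule: derives.induct)
  case (atom cs a)
  show ?case by simp
next
  case (var \<pi>' \<pi> cs X)
  note nom = comm_nom_algD(1)[OF alg]
  have x: "\<sigma> X \<in> univ A" and X: "X \<in> V"
    using \<sigma> var.prems(3) by auto
  have "act A (rename_perm \<rho> (inverse \<pi>' * \<pi>)) (\<sigma> X) = \<sigma> X"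
    by (rule PN_fixes[OF nom x supp[OF X] var.prems(5)[OF X] var.prems(6)[OF X] var.hyps])
  then have "act A (rename_perm \<rho> \<pi>') (\<sigma> X) =
      act A (rename_perm \<rho> \<pi>' * rename_perm \<rho> (inverse \<pi>' * \<pi>)) (\<sigma> X)"
    using nominal_setD(3)[OF nom x] by simp
  also have "rename_perm \<rho> \<pi>' * rename_perm \<rho> (inverse \<pi>' * \<pi>) = rename_perm \<rho> \<pi>"
    by (simp flip: rename_perm_times)
  finally show ?case
    by simp
next
  case (app f cs ts us)
  have len: "length ts = length us"
    using app.IH by (simp add: list_all2_lengthD)
  have "interp A \<sigma> (rename_trm \<rho> (ts ! i)) = interp A \<sigma> (rename_trm \<rho> (us ! i))"
    if "i < length ts" for i
  proof -
    have "ts ! i \<in> set ts" "us ! i \<in> set us"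
      using that len by auto
    then have "vars_trm (ts ! i) \<subseteq> V" "vars_trm (us ! i) \<subseteq> V"
      using app.prems(3,4) by auto
    moreover have "wf_trm ar (ts ! i)" "wf_trm ar (us ! i)"
      using app.prems(1,2) that len by (auto simp: list_all_length)
    ultimately show ?thesis
      using app.IH that app.prems(5,6) unfolding list_all2_conv_all_nth by blast
  qed
  then show ?case
    using len by (auto intro!: arg_cong[where f = "opn A f"] nth_equalityI)
next
  case (comm f cs s\<^sub>0 t\<^sub>0 s\<^sub>1 t\<^sub>1)
  let ?I = "\<lambda>t. interp A \<sigma> (rename_trm \<rho> t)"
  have "?I s\<^sub>0 = ?I t\<^sub>0 \<and> ?I s\<^sub>1 = ?I t\<^sub>1 \<or> ?I s\<^sub>0 = ?I t\<^sub>1 \<and> ?I s\<^sub>1 = ?I t\<^sub>0"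
    using comm.IH comm.prems by auto
  moreover have "?I t\<^sub>0 \<in> univ A" "?I t\<^sub>1 \<in> univ A"
    using comm.prems interp_in_univ[OF alg \<sigma>] by auto
  ultimately show ?case
    using comm_nom_algD(9)[OF alg \<open>C f\<close>] by auto
next
  case (abs_same cs t t' a)
  then show ?case by auto
next
  case (abs_diff c cs a b t s)
  have x: "interp A \<sigma> (rename_trm \<rho> t) \<in> univ A" "interp A \<sigma> (rename_trm \<rho> s) \<in> univ A"
    using abs_diff.prems interp_in_univ[OF alg \<sigma>] by auto
  obtain L L' where L: "finite L" "finite L'"
      "\<And>d. d \<notin> L \<Longrightarrow> abst A (\<rho> \<langle>$\<rangle> a) (interp A \<sigma> (rename_trm \<rho> t)) =
        abst A d (act A \<langle>\<rho> \<langle>$\<rangle> a \<leftrightarrow> d\<rangle> (interp A \<sigma> (rename_trm \<rho> t)))"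
      "\<And>d. d \<notin> L' \<Longrightarrow> abst A (\<rho> \<langle>$\<rangle> b) (interp A \<sigma> (rename_trm \<rho> s)) =
        abst A d (act A \<langle>\<rho> \<langle>$\<rangle> b \<leftrightarrow> d\<rangle> (interp A \<sigma> (rename_trm \<rho> s)))"
    using abst_fresh_eq[OF alg x(1), of "\<rho> \<langle>$\<rangle> a"] abst_fresh_eq[OF alg x(2), of "\<rho> \<langle>$\<rangle> b"]
    by auto
  have fin': "finite (atoms_ctx cs \<Upsilon> \<union> {a, b} \<union> atoms_trm t \<union> atoms_trm s \<union>
      (\<langle>$\<rangle>) (inverse \<rho>) ` (L \<union> L' \<union> (\<Union>X\<in>V. B X)))"
    using fin L by (auto simp: atoms_ctx_def finite_atoms_trm)
  \<comment> \<open>The image of \<open>e\<close> under \<open>\<rho>\<close> has to avoid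
    \<open>L\<close>, \<open>L'\<close> and the supports, so \<open>e\<close> avoids their inverse
    images.\<close>
  obtain e where e: "e \<notin> atoms_ctx cs \<Upsilon> \<union> {a, b} \<union> atoms_trm t \<union> atoms_trm s \<union>
      (\<langle>$\<rangle>) (inverse \<rho>) ` (L \<union> L' \<union> (\<Union>X\<in>V. B X))"
    using ex_new_if_finite[OF inf fin'] by (rule exE)
  have \<rho>e: "\<rho> \<langle>$\<rangle> e \<notin> L \<union> L' \<union> (\<Union>X\<in>V. B X)"
  proof
    assume "\<rho> \<langle>$\<rangle> e \<in> L \<union> L' \<union> (\<Union>X\<in>V. B X)"
    then have "inverse \<rho> \<langle>$\<rangle> (\<rho> \<langle>$\<rangle> e) \<in> (\<langle>$\<rangle>) (inverse \<rho>) ` (L \<union> L' \<union> (\<Union>X\<in>V. B X))"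
      by (rule imageI)
    with e show False by simp
  qed
  note c = abs_diff.hyps(1)
  \<comment> \<open>The swapping sends the given \<open>c\<close> to the good name
    \<open>\<rho> \<langle>$\<rangle> e\<close>. As neither \<open>c\<close> nor \<open>e\<close>
    occurs in \<open>t\<close> or \<open>s\<close>, it does not change how these are
    renamed.\<close>
  define \<rho>' where "\<rho>' = \<rho> * \<langle>c \<leftrightarrow> e\<rangle>"
  have \<rho>': "\<rho>' \<langle>$\<rangle> c = \<rho> \<langle>$\<rangle> e" "\<And>x. x \<noteq> c \<Longrightarrow> x \<noteq> e \<Longrightarrow> \<rho>' \<langle>$\<rangle> x = \<rho> \<langle>$\<rangle> x"
    by (simp_all add: \<rho>'_def)
  have rename: "rename_trm \<rho>' t = rename_trm \<rho> t" "rename_trm \<rho>' s = rename_trm \<rho> s"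
    unfolding \<rho>'_def rename_trm_times using c e affected_swap_subset[of c e]
    by (auto intro!: arg_cong[where f = "rename_trm \<rho>"] rename_trm_id)
  have c_ctx: "c \<notin> atoms_ctx cs \<Upsilon>"
    using c by simp
  have "interp A \<sigma> (rename_trm \<rho>' (perm_trm \<langle>a \<leftrightarrow> c\<rangle> t)) =
      interp A \<sigma> (rename_trm \<rho>' (perm_trm \<langle>b \<leftrightarrow> c\<rangle> s))"
  proof (rule abs_diff.IH)
    fix X d assume X: "X \<in> V" and d: "d \<in> F_atoms (cs @ [c]) \<Upsilon> X"
    show "\<rho>' \<langle>$\<rangle> d \<notin> B X"
    proof (cases "d = c")
      case True
      then show ?thesis using X \<rho>e \<rho>' by auto
    next
      case False
      then have d': "d \<in> F_atoms cs \<Upsilon> X"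
        using d by (simp add: F_atoms_snoc_fresh[OF c_ctx])
      then have "d \<noteq> e"
        using e F_atoms_subset[of cs \<Upsilon> X] by auto
      then show ?thesis
        using False \<rho>' abs_diff.prems(5)[OF X d'] by simp
    qed
  next
    fix X k assume X: "X \<in> V" and "k \<in> P_perms (cs @ [c]) \<Upsilon> X"
    then have k: "k \<in> P_perms cs \<Upsilon> X"
      by (simp add: P_perms_snoc_fresh[OF c_ctx])
    then have "affected k \<subseteq> atoms_ctx cs \<Upsilon>"
      using affected_cycles_avoiding affected_subset_atoms_ctx[of _ X \<Upsilon> cs]
      by (fastforce simp: P_perms_def)
    then have "rename_perm \<langle>c \<leftrightarrow> e\<rangle> k = k"
      using c_ctx e affected_swap_subset[of c e] by (intro rename_perm_id) auto
    then show "act A (rename_perm \<rho>' k) (\<sigma> X) = \<sigma> X"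
      using abs_diff.prems(6)[OF X k] by (simp add: \<rho>'_def rename_perm_by_times)
  qed (use abs_diff.prems in auto)
  moreover have "\<rho>' \<langle>$\<rangle> a = \<rho> \<langle>$\<rangle> a" "\<rho>' \<langle>$\<rangle> b = \<rho> \<langle>$\<rangle> b"
    using c e by (auto intro!: \<rho>'(2))
  \<comment> \<open>Conjugation by \<open>\<rho>'\<close> turns swappings with \<open>c\<close> into
    swappings with \<open>\<rho> \<langle>$\<rangle> e\<close>, the name to which both abstractions
    can be renamed.\<close>
  ultimately have "act A \<langle>\<rho> \<langle>$\<rangle> a \<leftrightarrow> \<rho> \<langle>$\<rangle> e\<rangle> (interp A \<sigma> (rename_trm \<rho> t)) =
      act A \<langle>\<rho> \<langle>$\<rangle> b \<leftrightarrow> \<rho> \<langle>$\<rangle> e\<rangle> (interp A \<sigma> (rename_trm \<rho> s))"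
    using abs_diff.prems(1,2)
    by (simp add: rename_perm_trm rename_perm_swap rename \<rho>'(1) interp_perm_trm[OF alg \<sigma>])
  then show ?case
    using L(3,4)[of "\<rho> \<langle>$\<rangle> e"] \<rho>e by simp
qed

text \<open>A renamed constraint fixes \<open>x\<close>, so it permutes the supports of \<open>x\<close>; each of its cycles
  that meets \<open>cs\<close> contains a name outside some support, hence all its atoms are fresh for \<open>x\<close>.\<close>

lemma context_valid_supports:
  fixes A :: "('a, 'f, 'x) nom_alg"
  assumes inf: "infinite (UNIV :: 'a set)" and nom: "nominal_set (univ A) (act A)"
    and x: "\<sigma> X \<in> univ A" and ctx: "fp_context cs \<Upsilon>" and valid: "context_valid A \<sigma> cs \<Upsilon>"
  shows "\<exists>B. finite B \<and> B \<inter> (F_atoms cs \<Upsilon> X - set cs) = {} \<and> supports (act A) B (\<sigma> X)"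
proof (rule supports_avoiding[OF inf nom x])
  show "finite (F_atoms cs \<Upsilon> X - set cs)"
    by (rule finite_Diff, rule finite_subset[OF F_atoms_subset finite_atoms_ctx[OF ctx]])
  fix a assume "a \<in> F_atoms cs \<Upsilon> X - set cs"
  then obtain \<pi> where \<pi>: "(\<pi>, X) \<in> \<Upsilon>" "\<pi> = cycles_meeting cs \<pi>" "a \<in> affected \<pi>" "a \<notin> set cs"
    by (auto simp: F_atoms_def)
  obtain B where B: "finite B" "supports (act A) B (\<sigma> X)"
    using nominal_setD(4)[OF nom x] by blast
  have fin: "finite (set cs \<union> B \<union> {a})"
    using B(1) by simp
  have "new_quant (length cs) (\<lambda>ds. act A (rename_perm (swaps cs ds) \<pi>) (\<sigma> X) = \<sigma> X)"
    using valid \<pi>(1) by (auto simp: context_valid_def)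
  then obtain ds where ds: "length ds = length cs" "distinct ds" "set ds \<inter> (set cs \<union> B \<union> {a}) = {}"
      "act A (rename_perm (swaps cs ds) \<pi>) (\<sigma> X) = \<sigma> X"
    by (rule new_quantE[OF inf fin])
  let ?\<rho> = "swaps cs ds" and ?\<pi>' = "rename_perm (swaps cs ds) \<pi>"
  have "Perm.orbit \<pi> a \<inter> set cs \<noteq> {}"
    using \<pi>(2,3) by (metis apply_cycles_meeting in_affected)
  then obtain n where n: "(\<pi> ^ n) \<langle>$\<rangle> a \<in> set cs"
    by (auto simp: Perm.orbit_def)
  have \<rho>a: "?\<rho> \<langle>$\<rangle> a = a"
    using \<pi>(4) ds(3) by (intro swaps_outside) auto
  then have "inverse ?\<rho> \<langle>$\<rangle> a = a"
    by (metis apply_inverse_cancel(2))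
  then have "(?\<pi>' ^ n) \<langle>$\<rangle> a = ?\<rho> \<langle>$\<rangle> ((\<pi> ^ n) \<langle>$\<rangle> a)"
    unfolding rename_perm_power by (simp add: rename_perm_def)
  moreover have "?\<rho> \<langle>$\<rangle> ((\<pi> ^ n) \<langle>$\<rangle> a) \<in> set ds"
    using ctx n ds by (intro swaps_in) (auto simp: fp_context_def)
  ultimately have "(?\<pi>' ^ n) \<langle>$\<rangle> a \<notin> B"
    using ds(3) by auto
  \<comment> \<open>The power fixes the value, so the inverse image of the support \<open>B\<close>
    under it is a support too; it omits \<open>a\<close>, since the power takes \<open>a\<close> out
    of \<open>B\<close>.\<close>
  then have "a \<notin> (\<langle>$\<rangle>) (inverse (?\<pi>' ^ n)) ` B"
    by auto
  moreover have "supports (act A) ((\<langle>$\<rangle>) (inverse (?\<pi>' ^ n)) ` B) (\<sigma> X)"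
    by (intro supports_image[OF nom x B(2)] act_inverse_eq[OF nom x] act_power_eq[OF nom x] ds(4))
  ultimately show "\<exists>B. finite B \<and> a \<notin> B \<and> supports (act A) B (\<sigma> X)"
    using B(1) by blast
qed

text \<open>A permutation disjoint from \<open>cs\<close> commutes with the replacement of
  \<open>cs\<close> by names it does not move, so the quantifier disappears from its
  constraint.\<close>

lemma context_valid_P_perms:
  fixes A :: "('a, 'f, 'x) nom_alg"
  assumes inf: "infinite (UNIV :: 'a set)" and nom: "nominal_set (univ A) (act A)"
    and x: "\<sigma> X \<in> univ A" and ctx: "fp_context cs \<Upsilon>" and valid: "context_valid A \<sigma> cs \<Upsilon>"
    and k: "k \<in> P_perms cs \<Upsilon> X"
  shows "act A k (\<sigma> X) = \<sigma> X"
proof -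
  from k obtain \<pi> where \<pi>: "(\<pi>, X) \<in> \<Upsilon>" "k = cycles_avoiding cs \<pi>"
    by (auto simp: P_perms_def)
  consider "k = 1" | "k = \<pi>"
    using fp_context_split[OF ctx \<pi>(1)] \<pi>(2) by auto
  then show ?thesis
  proof cases
    case 1
    then show ?thesis using nominal_setD(2)[OF nom x] by simp
  next
    case 2
    have "new_quant (length cs) (\<lambda>ds. act A (rename_perm (swaps cs ds) \<pi>) (\<sigma> X) = \<sigma> X)"
      using valid \<pi>(1) by (auto simp: context_valid_def)
    then obtain ds where ds: "set ds \<inter> affected \<pi> = {}"
        "act A (rename_perm (swaps cs ds) \<pi>) (\<sigma> X) = \<sigma> X"
      by (rule new_quantE[OF inf finite_affected[of \<pi>]])
    have "affected \<pi> \<inter> set cs = {}"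
      using affected_cycles_avoiding[of cs \<pi>] 2 \<pi>(2) by auto
    then have "rename_perm (swaps cs ds) \<pi> = \<pi>"
      using ds(1) affected_swaps[of cs ds] by (intro rename_perm_id) blast
    with ds(2) 2 show ?thesis by simp
  qed
qed

text \<open>The renaming is \<open>swaps cs ds\<close> with \<open>ds\<close> fresh for the context
  and the chosen supports. These supports already omit the atoms of
  \<open>F_atoms cs \<Upsilon> X\<close> outside \<open>cs\<close>; the names in \<open>cs\<close>,
  which they may contain, are moved to \<open>ds\<close>.\<close>

lemma derives_sound:
  fixes A :: "('a, 'f, 'x) nom_alg"
  assumes inf: "infinite (UNIV :: 'a set)"
    and ctx: "fp_context cs \<Upsilon>" and wf: "wf_trm ar t" "wf_trm ar u"
    and alg: "comm_nom_alg ar C A" and \<sigma>: "range \<sigma> \<subseteq> univ A" and der: "derives C \<Upsilon> cs t u"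
  shows "judgement_valid A \<sigma> cs \<Upsilon> t u"
  unfolding judgement_valid_def
proof
  assume valid: "context_valid A \<sigma> cs \<Upsilon>"
  note nom = comm_nom_algD(1)[OF alg]
  have x: "\<sigma> X \<in> univ A" for X
    using \<sigma> by auto
  obtain B where B: "\<And>X. finite (B X)" "\<And>X. B X \<inter> (F_atoms cs \<Upsilon> X - set cs) = {}"
      "\<And>X. supports (act A) (B X) (\<sigma> X)"
    using context_valid_supports[OF inf nom x ctx valid] by metis
  let ?V = "vars_trm t \<union> vars_trm u"
  show "new_quant (length cs) (\<lambda>ds.
      interp A \<sigma> (rename_trm (swaps cs ds) t) = interp A \<sigma> (rename_trm (swaps cs ds) u))"
  proof (rule new_quantI)
    show "finite (atoms_ctx cs \<Upsilon> \<union> (\<Union>X\<in>?V. B X))"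
      using finite_atoms_ctx[OF ctx] B(1) by (auto simp: finite_vars_trm)
    fix ds :: "'a list"
    assume ds: "length ds = length cs" "distinct ds" "set ds \<inter> (atoms_ctx cs \<Upsilon> \<union> (\<Union>X\<in>?V. B X)) = {}"
    have dist: "distinct cs" and fin: "finite \<Upsilon>"
      using ctx by (simp_all add: fp_context_def)
    have cs: "set cs \<subseteq> atoms_ctx cs \<Upsilon>"
      by (simp add: atoms_ctx_def)
    show "interp A \<sigma> (rename_trm (swaps cs ds) t) = interp A \<sigma> (rename_trm (swaps cs ds) u)"
    proof (rule derives_interp_eq[OF inf alg \<sigma> fin _ B(1) B(3) der wf, where V = ?V])
      fix X a assume X: "X \<in> ?V" and a: "a \<in> F_atoms cs \<Upsilon> X"
      show "swaps cs ds \<langle>$\<rangle> a \<notin> B X"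
      proof (cases "a \<in> set cs")
        case True
        then have "swaps cs ds \<langle>$\<rangle> a \<in> set ds"
          using dist ds cs by (intro swaps_in) auto
        then show ?thesis using ds(3) X by auto
      next
        case False
        then have "swaps cs ds \<langle>$\<rangle> a = a"
          using a ds(3) F_atoms_subset[of cs \<Upsilon> X] by (intro swaps_outside) auto
        then show ?thesis using B(2)[of X] a False by auto
      qed
    next
      fix X k assume k: "k \<in> P_perms cs \<Upsilon> X"
      have "set cs \<subseteq> F_atoms cs \<Upsilon> X"
        by (simp add: F_atoms_def)
      then have "rename_perm (swaps cs ds) k = k"
        using affected_P_perms[OF ctx k] affected_swaps[of cs ds] ds(3)
        by (intro rename_perm_id) blast
      then show "act A (rename_perm (swaps cs ds) k) (\<sigma> X) = \<sigma> X"
        using context_valid_P_perms[OF inf nom x ctx valid k] by simp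
    qed (auto simp: finite_vars_trm)
  qed
qed


section \<open>Equality of terms relative to stabilisers of the variables\<close>

lemma perm_trm_swap:
  "perm_trm \<pi> (perm_trm \<langle>a \<leftrightarrow> b\<rangle> t) = perm_trm \<langle>\<pi> \<langle>$\<rangle> a \<leftrightarrow> \<pi> \<langle>$\<rangle> b\<rangle> (perm_trm \<pi> t)"
  unfolding rename_perm_swap[symmetric] perm_trm_times[symmetric]
  by (simp add: rename_perm_def mult.assoc)

lemma atoms_perm_trm: "atoms_trm (perm_trm \<pi> t) \<subseteq> atoms_trm t \<union> affected \<pi>"
proof (induction t)
  case (Susp \<pi>' X)
  then show ?case using affected_times[of \<pi> \<pi>'] by (simp add: Un_commute)
qed (auto simp: in_affected apply_inj)

text \<open>The cofinite abstraction rule makes transitivity and equivariance immediate, and yields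
  premises for as fresh a name as needed.\<close>

inductive aeq ::
  "('f \<Rightarrow> bool) \<Rightarrow> ('v \<Rightarrow> 'a perm set) \<Rightarrow> ('a, 'v, 'f) trm \<Rightarrow> ('a, 'v, 'f) trm \<Rightarrow> bool"
  for C :: "'f \<Rightarrow> bool" and G :: "'v \<Rightarrow> 'a perm set" where
  atom: "aeq C G (Atom a) (Atom a)"
| var: "inverse \<pi>' * \<pi> \<in> G X \<Longrightarrow> aeq C G (Susp \<pi> X) (Susp \<pi>' X)"
| app: "\<lbrakk>\<not> C f; list_all2 (aeq C G) ts us\<rbrakk> \<Longrightarrow> aeq C G (App f ts) (App f us)"
| comm: "\<lbrakk>C f; aeq C G s\<^sub>0 t\<^sub>0 \<and> aeq C G s\<^sub>1 t\<^sub>1 \<or> aeq C G s\<^sub>0 t\<^sub>1 \<and> aeq C G s\<^sub>1 t\<^sub>0\<rbrakk>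
    \<Longrightarrow> aeq C G (App f [s\<^sub>0, s\<^sub>1]) (App f [t\<^sub>0, t\<^sub>1])"
| abs: "\<lbrakk>finite L; \<And>c. c \<notin> L \<Longrightarrow> aeq C G (perm_trm \<langle>a \<leftrightarrow> c\<rangle> t) (perm_trm \<langle>b \<leftrightarrow> c\<rangle> s)\<rbrakk>
    \<Longrightarrow> aeq C G (Abs a t) (Abs b s)"

inductive_cases aeq_AtomE: "aeq C G (Atom a) u"
inductive_cases aeq_SuspE: "aeq C G (Susp \<pi> X) u"
inductive_cases aeq_AppE: "aeq C G (App f ts) u"
inductive_cases aeq_AbsE: "aeq C G (Abs a t) u"

lemma aeq_perm_trm: "aeq C G t u \<Longrightarrow> aeq C G (perm_trm \<pi> t) (perm_trm \<pi> u)"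
proof (induction rule: aeq.induct)
  case (var \<pi>' \<pi>'' X)
  then show ?case by (auto intro!: aeq.var simp: mult.assoc)
next
  case (app f ts us)
  then show ?case
    by (auto intro!: aeq.app simp: list.rel_map elim!: list_all2_mono)
next
  case (abs L a t b s)
  have "aeq C G (perm_trm \<langle>\<pi> \<langle>$\<rangle> a \<leftrightarrow> c\<rangle> (perm_trm \<pi> t)) (perm_trm \<langle>\<pi> \<langle>$\<rangle> b \<leftrightarrow> c\<rangle> (perm_trm \<pi> s))"
    if c: "c \<notin> (\<langle>$\<rangle>) \<pi> ` L" for c
  proof -
    have "inverse \<pi> \<langle>$\<rangle> c \<notin> L"
      using c by (metis apply_inverse_cancel(1) imageI)
    from abs.IH[OF this] show ?thesis
      by (simp add: perm_trm_swap)
  qed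
  then show ?case
    using abs.hyps by (auto intro!: aeq.abs[of "(\<langle>$\<rangle>) \<pi> ` L"])
qed (auto intro: aeq.intros)

lemma aeq_Abs: "aeq C G t u \<Longrightarrow> aeq C G (Abs a t) (Abs a u)"
  by (auto intro!: aeq.abs[of "{}"] aeq_perm_trm)

lemma aeq_App:
  assumes "comm_signature ar C" "list_all2 (aeq C G) ts us" "length ts = ar f"
  shows "aeq C G (App f ts) (App f us)"
proof (cases "C f")
  case True
  then have "length ts = 2"
    using assms by (simp add: comm_signature_def)
  moreover have "length us = length ts"
    using assms(2) by (simp add: list_all2_lengthD)
  ultimately obtain s\<^sub>0 s\<^sub>1 t\<^sub>0 t\<^sub>1 where "ts = [s\<^sub>0, s\<^sub>1]" "us = [t\<^sub>0, t\<^sub>1]"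
    by (auto simp: length_Suc_conv numeral_2_eq_2)
  then show ?thesis
    using True assms(2) by (auto intro!: aeq.comm)
qed (use assms in \<open>auto intro: aeq.app\<close>)

text \<open>\<open>G X\<close> is to be the stabiliser of the class of \<open>Susp 1 X\<close>.
  Being a subgroup makes \<open>aeq\<close> an equivalence on well-formed terms; containing all
  permutations away from a finite set gives the classes finite support.\<close>

locale stabilisers =
  fixes ar :: "'f \<Rightarrow> nat" and C :: "'f \<Rightarrow> bool" and G :: "'v \<Rightarrow> 'a perm set"
  assumes sig: "comm_signature ar C"
    and one_G: "1 \<in> G X" and inverse_G: "\<pi> \<in> G X \<Longrightarrow> inverse \<pi> \<in> G X"
    and times_G: "\<pi> \<in> G X \<Longrightarrow> \<pi>' \<in> G X \<Longrightarrow> \<pi> * \<pi>' \<in> G X"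
    and support_G: "\<exists>S. finite S \<and> (\<forall>\<pi>. affected \<pi> \<inter> S = {} \<longrightarrow> \<pi> \<in> G X)"
begin

lemma aeq_refl: "wf_trm ar t \<Longrightarrow> aeq C G t t"
proof (induction t)
  case (App f ts)
  then show ?case
    by (auto intro!: aeq_App[OF sig] simp: list_all_iff list_all2_same)
qed (auto intro: aeq.intros aeq_Abs simp: one_G)

lemma aeq_sym: "aeq C G t u \<Longrightarrow> aeq C G u t"
proof (induction rule: aeq.induct)
  case (var \<pi>' \<pi> X)
  then show ?case
    using inverse_G[of "inverse \<pi>' * \<pi>" X] by (auto intro!: aeq.var)
next
  case (app f ts us)
  then show ?case
    by (auto intro!: aeq.app simp: list_all2_conv_all_nth)
qed (auto intro: aeq.intros)

lemma aeq_trans: "aeq C G t u \<Longrightarrow> aeq C G u v \<Longrightarrow> aeq C G t v"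
proof (induction arbitrary: v rule: aeq.induct)
  case (var \<pi>' \<pi> X)
  from var.prems obtain \<pi>'' where v: "v = Susp \<pi>'' X" "inverse \<pi>'' * \<pi>' \<in> G X"
    by (auto elim: aeq_SuspE)
  then show ?case
    using times_G[OF v(2) var.hyps] by (auto intro!: aeq.var simp: mult.assoc)
next
  case (app f ts us)
  from app.prems obtain vs where "v = App f vs" "list_all2 (aeq C G) us vs"
    using app.hyps by (auto elim: aeq_AppE)
  then show ?case
    using app by (auto intro!: aeq.app simp: list_all2_conv_all_nth)
next
  case (comm f s\<^sub>0 t\<^sub>0 s\<^sub>1 t\<^sub>1)
  from comm.prems obtain v\<^sub>0 v\<^sub>1 where "v = App f [v\<^sub>0, v\<^sub>1]"
      "aeq C G t\<^sub>0 v\<^sub>0 \<and> aeq C G t\<^sub>1 v\<^sub>1 \<or> aeq C G t\<^sub>0 v\<^sub>1 \<and> aeq C G t\<^sub>1 v\<^sub>0"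
    using comm.hyps by (auto elim: aeq_AppE)
  then show ?case
    using comm by (auto intro!: aeq.comm)
next
  case (abs L a t b s)
  from abs.prems obtain L' d r where "v = Abs d r" "finite L'"
      "\<And>c. c \<notin> L' \<Longrightarrow> aeq C G (perm_trm \<langle>b \<leftrightarrow> c\<rangle> s) (perm_trm \<langle>d \<leftrightarrow> c\<rangle> r)"
    by (auto elim: aeq_AbsE)
  then show ?case
    using abs by (auto intro!: aeq.abs[of "L \<union> L'"])
qed (auto elim: aeq_AtomE)

lemma aeq_support:
  "wf_trm ar t \<Longrightarrow> \<exists>B. finite B \<and> (\<forall>\<pi>. affected \<pi> \<inter> B = {} \<longrightarrow> aeq C G (perm_trm \<pi> t) t)"
proof (induction t)
  case (Atom a)
  show ?case
    by (intro exI[of _ "{a}"]) (auto simp: in_affected intro: aeq.atom)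
next
  case (Susp \<tau> X)
  obtain S where S: "finite S" "\<And>\<pi>. affected \<pi> \<inter> S = {} \<Longrightarrow> \<pi> \<in> G X"
    using support_G by blast
  \<comment> \<open>The support is carried along \<open>\<tau>\<close>: conjugating by
    \<open>inverse \<tau>\<close> brings \<open>\<pi>\<close> back to a permutation away from
    \<open>S\<close>.\<close>
  have "aeq C G (perm_trm \<pi> (Susp \<tau> X)) (Susp \<tau> X)" if \<pi>: "affected \<pi> \<inter> (\<langle>$\<rangle>) \<tau> ` S = {}" for \<pi>
  proof -
    have "a \<notin> affected (rename_perm (inverse \<tau>) \<pi>)" if "a \<in> S" for a
    proof -
      have "\<tau> \<langle>$\<rangle> a \<notin> affected \<pi>"
        using \<pi> that by blast
      then show ?thesis
        by (simp add: in_affected rename_perm_def)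
    qed
    then have "affected (rename_perm (inverse \<tau>) \<pi>) \<inter> S = {}"
      by auto
    then have "rename_perm (inverse \<tau>) \<pi> \<in> G X"
      by (rule S(2))
    then show ?thesis
      by (auto intro!: aeq.var simp: rename_perm_def mult.assoc)
  qed
  then show ?case
    using S(1) by (intro exI[of _ "(\<langle>$\<rangle>) \<tau> ` S"]) auto
next
  case (App f ts)
  then have "\<forall>t\<in>set ts. \<exists>B. finite B \<and> (\<forall>\<pi>. affected \<pi> \<inter> B = {} \<longrightarrow> aeq C G (perm_trm \<pi> t) t)"
    by (auto simp: list_all_iff)
  then obtain B where B: "\<And>t. t \<in> set ts \<Longrightarrow> finite (B t)"
      "\<And>t \<pi>. t \<in> set ts \<Longrightarrow> affected \<pi> \<inter> B t = {} \<Longrightarrow> aeq C G (perm_trm \<pi> t) t"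
    by metis
  show ?case
  proof (intro exI[of _ "\<Union> (B ` set ts)"] conjI allI impI)
    fix \<pi> :: "'a perm" assume "affected \<pi> \<inter> \<Union> (B ` set ts) = {}"
    then have "list_all2 (aeq C G) (map (perm_trm \<pi>) ts) ts"
      by (auto simp: list.rel_map list_all2_same intro!: B(2))
    then show "aeq C G (perm_trm \<pi> (App f ts)) (App f ts)"
      using App.prems by (auto intro!: aeq_App[OF sig])
  qed (auto simp: B(1))
next
  case (Abs a t)
  then obtain B where B: "finite B" "\<And>\<pi>. affected \<pi> \<inter> B = {} \<Longrightarrow> aeq C G (perm_trm \<pi> t) t"
    by auto
  have "aeq C G (perm_trm \<pi> (Abs a t)) (Abs a t)" if "affected \<pi> \<inter> insert a B = {}" for \<pi>
    using that B(2)[of \<pi>] by (auto simp: apply_outside_affected intro!: aeq_Abs)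
  then show ?case
    using B(1) by (intro exI[of _ "insert a B"]) auto
qed

text \<open>This becomes the abstraction axiom of the term model. For fresh \<open>c\<close> and
  \<open>d\<close>, \<open>\<langle>c \<leftrightarrow> d\<rangle> * \<langle>a \<leftrightarrow>
  c\<rangle> = \<langle>a \<leftrightarrow> d\<rangle> * \<langle>c \<leftrightarrow>
  d\<rangle>\<close>, and \<open>\<langle>c \<leftrightarrow> d\<rangle>\<close> fixes
  \<open>t\<close> up to \<open>aeq\<close>.\<close>

lemma aeq_Abs_fresh:
  assumes "wf_trm ar t"
  shows "\<forall>\<^sub>\<infinity>c. aeq C G (Abs c (perm_trm \<langle>a \<leftrightarrow> c\<rangle> t)) (Abs a t)"
proof -
  obtain B where B: "finite B" "\<And>\<pi>. affected \<pi> \<inter> B = {} \<Longrightarrow> aeq C G (perm_trm \<pi> t) t"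
    using aeq_support[OF assms] by auto
  have "aeq C G (Abs c (perm_trm \<langle>a \<leftrightarrow> c\<rangle> t)) (Abs a t)" if c: "c \<notin> insert a B" for c
  proof (rule aeq.abs)
    show "finite (insert a (insert c B))"
      using B(1) by simp
    fix d assume d: "d \<notin> insert a (insert c B)"
    have "\<langle>c \<leftrightarrow> d\<rangle> * \<langle>a \<leftrightarrow> c\<rangle> = \<langle>a \<leftrightarrow> d\<rangle> * \<langle>c \<leftrightarrow> d\<rangle>"
    proof (rule perm_eqI)
      fix x
      show "(\<langle>c \<leftrightarrow> d\<rangle> * \<langle>a \<leftrightarrow> c\<rangle>) \<langle>$\<rangle> x = (\<langle>a \<leftrightarrow> d\<rangle> * \<langle>c \<leftrightarrow> d\<rangle>) \<langle>$\<rangle> x"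
        using c d by (cases "x = a"; cases "x = c"; cases "x = d") auto
    qed
    then have "perm_trm \<langle>c \<leftrightarrow> d\<rangle> (perm_trm \<langle>a \<leftrightarrow> c\<rangle> t) = perm_trm \<langle>a \<leftrightarrow> d\<rangle> (perm_trm \<langle>c \<leftrightarrow> d\<rangle> t)"
      by (simp flip: perm_trm_times)
    moreover have "aeq C G (perm_trm \<langle>c \<leftrightarrow> d\<rangle> t) t"
      using c d affected_swap_subset[of c d] by (intro B(2)) auto
    ultimately show "aeq C G (perm_trm \<langle>c \<leftrightarrow> d\<rangle> (perm_trm \<langle>a \<leftrightarrow> c\<rangle> t)) (perm_trm \<langle>a \<leftrightarrow> d\<rangle> t)"
      by (simp add: aeq_perm_trm)
  qed
  then have "{c. \<not> aeq C G (Abs c (perm_trm \<langle>a \<leftrightarrow> c\<rangle> t)) (Abs a t)} \<subseteq> insert a B"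
    by auto
  then show ?thesis
    using B(1) by (auto simp: eventually_cofinite intro: finite_subset)
qed

text \<open>On a suspension the renaming differs from the action by a factor
  \<open>inverse \<rho>\<close> next to the variable, which \<open>G X\<close> absorbs.\<close>

lemma rename_trm_aeq_perm_trm:
  assumes "\<And>X. \<rho> \<in> G X"
  shows "wf_trm ar t \<Longrightarrow> aeq C G (rename_trm \<rho> t) (perm_trm \<rho> t)"
proof (induction t)
  case (Susp \<pi> X)
  show ?case
    using inverse_G[OF assms] by (auto intro!: aeq.var simp: rename_perm_def mult.assoc)
next
  case (App f ts)
  then show ?case
    by (auto intro!: aeq_App[OF sig] simp: list.rel_map list_all2_same list_all_iff)
qed (auto intro: aeq.atom aeq_Abs)


section \<open>The term model\<close>

definition cls :: "('a, 'v, 'f) trm \<Rightarrow> ('a, 'v, 'f) trm set" where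
  "cls t = {s. wf_trm ar s \<and> aeq C G t s}"

definition rep :: "('a, 'v, 'f) trm set \<Rightarrow> ('a, 'v, 'f) trm" where
  "rep x = (SOME t. t \<in> x)"

text \<open>The operations are computed on chosen representatives; \<open>act_model\<close>,
  \<open>abst_model\<close> and \<open>opn_model\<close> free them from the choice, because
  \<open>aeq\<close> is a congruence. Elements are sets of terms, the carrier type at which
  completeness is stated.\<close>

definition model :: "('a, 'f, ('a, 'v, 'f) trm set) nom_alg" where
  "model = \<lparr>univ = cls ` {t. wf_trm ar t}, act = \<lambda>\<pi> x. cls (perm_trm \<pi> (rep x)),
    atm = \<lambda>a. cls (Atom a), abst = \<lambda>a x. cls (Abs a (rep x)),
    opn = \<lambda>f xs. cls (App f (map rep xs))\<rparr>"

lemma cls_eqI: "aeq C G t u \<Longrightarrow> cls t = cls u"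
  unfolding cls_def using aeq_sym aeq_trans by blast

lemma cls_eq_iff: "wf_trm ar u \<Longrightarrow> cls t = cls u \<longleftrightarrow> aeq C G t u"
  using cls_eqI[of t u] aeq_refl[of u] unfolding cls_def by blast

lemma rep_cls:
  assumes "wf_trm ar t"
  shows "aeq C G (rep (cls t)) t"
proof -
  have "t \<in> cls t"
    using assms by (simp add: cls_def aeq_refl)
  then have "rep (cls t) \<in> cls t"
    unfolding rep_def by (rule someI)
  then show ?thesis
    by (simp add: cls_def aeq_sym)
qed

lemma univ_model: "univ model = cls ` {t. wf_trm ar t}"
  by (simp add: model_def)

lemma atm_model: "atm model a = cls (Atom a)"
  by (simp add: model_def)

lemma act_model: "wf_trm ar t \<Longrightarrow> act model \<pi> (cls t) = cls (perm_trm \<pi> t)"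
  by (simp add: model_def cls_eqI aeq_perm_trm rep_cls)

lemma abst_model: "wf_trm ar t \<Longrightarrow> abst model a (cls t) = cls (Abs a t)"
  by (simp add: model_def cls_eqI aeq_Abs rep_cls)

lemma opn_model:
  assumes "wf_trm ar (App f ts)"
  shows "opn model f (map cls ts) = cls (App f ts)"
proof -
  have "list_all2 (aeq C G) (map (rep \<circ> cls) ts) ts"
    using assms by (auto simp: list.rel_map list_all2_same list_all_iff rep_cls)
  then show ?thesis
    using assms by (auto simp: model_def intro!: cls_eqI aeq_App[OF sig])
qed

lemma univ_model_listE:
  assumes "set xs \<subseteq> univ model"
  obtains ts where "xs = map cls ts" "list_all (wf_trm ar) ts"
proof -
  have "\<exists>ts. xs = map cls ts \<and> list_all (wf_trm ar) ts"
    using assms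
  proof (induction xs)
    case (Cons x xs)
    then obtain t ts where "x = cls t" "wf_trm ar t" "xs = map cls ts" "list_all (wf_trm ar) ts"
      by (auto simp: univ_model)
    then show ?case
      by (intro exI[of _ "t # ts"]) simp
  qed simp
  with that show thesis by blast
qed

lemma nominal_set_model: "nominal_set (univ model) (act model)"
proof -
  have "\<exists>B. finite B \<and> supports (act model) B (cls t)" if t: "wf_trm ar t" for t
  proof -
    obtain B where B: "finite B" "\<And>\<pi>. affected \<pi> \<inter> B = {} \<Longrightarrow> aeq C G (perm_trm \<pi> t) t"
      using aeq_support[OF t] by auto
    have "act model \<pi> (cls t) = cls t" if "\<forall>a\<in>B. \<pi> \<langle>$\<rangle> a = a" for \<pi>
    proof -
      have "affected \<pi> \<inter> B = {}"
        using that by (auto simp: in_affected)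
      then show ?thesis
        by (simp add: act_model[OF t] cls_eqI B(2))
    qed
    then show ?thesis
      using B(1) by (auto simp: supports_def)
  qed
  then show ?thesis
    unfolding nominal_set_def univ_model by (auto simp: act_model perm_trm_times)
qed

lemma comm_nom_alg_model: "comm_nom_alg ar C model"
  unfolding comm_nom_alg_def
proof (intro conjI allI impI ballI)
  show "nominal_set (univ model) (act model)"
    by (rule nominal_set_model)
  show "range (atm model) \<subseteq> univ model"
    by (auto simp: atm_model univ_model)
  show "inj (atm model)"
    by (auto simp: inj_def atm_model cls_eq_iff elim: aeq_AtomE)
  show "act model \<pi> (atm model a) = atm model (\<pi> \<langle>$\<rangle> a)" for \<pi> a
    by (simp add: atm_model act_model)
  fix a x assume "x \<in> univ model"
  then obtain t where t: "x = cls t" "wf_trm ar t"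
    by (auto simp: univ_model)
  then show "abst model a x \<in> univ model"
    by (auto simp: abst_model univ_model)
  show "act model \<pi> (abst model a x) = abst model (\<pi> \<langle>$\<rangle> a) (act model \<pi> x)" for \<pi>
    using t by (simp add: abst_model act_model)
  show "\<forall>\<^sub>\<infinity>c. act model \<langle>a \<leftrightarrow> c\<rangle> (abst model a x) = abst model a x"
    using aeq_Abs_fresh[OF t(2), of a] t
    by (auto simp: abst_model act_model elim!: eventually_mono intro!: cls_eqI)
next
  fix f and xs :: "('a, 'v, 'f) trm set list"
  assume xs: "length xs = ar f \<and> set xs \<subseteq> univ model"
  then obtain ts where ts: "xs = map cls ts" "list_all (wf_trm ar) ts"
    using univ_model_listE by blast
  then have wf: "wf_trm ar (App f ts)"
    using xs by simp
  then have op: "opn model f xs = cls (App f ts)"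
    unfolding ts(1) by (rule opn_model)
  then show "opn model f xs \<in> univ model"
    using wf by (auto simp: univ_model)
  fix \<pi>
  have "map (act model \<pi>) xs = map cls (map (perm_trm \<pi>) ts)"
    using ts by (auto simp: list_all_iff act_model)
  moreover have "wf_trm ar (App f (map (perm_trm \<pi>) ts))"
    using wf by (auto simp: list_all_iff)
  ultimately show "act model \<pi> (opn model f xs) = opn model f (map (act model \<pi>) xs)"
    by (simp only: op act_model[OF wf] opn_model perm_trm.simps)
next
  fix f x y assume f: "C f" and "x \<in> univ model" "y \<in> univ model"
  then obtain s t where st: "x = cls s" "y = cls t" "wf_trm ar s" "wf_trm ar t"
    by (auto simp: univ_model)
  have "ar f = 2"
    using sig f by (simp add: comm_signature_def)
  then have "opn model f [x, y] = cls (App f [s, t])" "opn model f [y, x] = cls (App f [t, s])"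
    using opn_model[of f "[s, t]"] opn_model[of f "[t, s]"] st by simp_all
  moreover have "aeq C G (App f [s, t]) (App f [t, s])"
    using f st by (auto intro!: aeq.comm aeq_refl)
  ultimately show "opn model f [x, y] = opn model f [y, x]"
    by (simp add: cls_eqI)
qed

text \<open>Under the valuation taking each variable to its own class, interpretation is the
  quotient map; with \<open>cls_eq_iff\<close>, equations in the model become instances of
  \<open>aeq\<close>.\<close>

lemma interp_model: "wf_trm ar t \<Longrightarrow> interp model (\<lambda>X. cls (Susp 1 X)) t = cls t"
proof (induction t)
  case (App f ts)
  then have "map (interp model (\<lambda>X. cls (Susp 1 X))) ts = map cls ts"
    by (auto simp: list_all_iff)
  then show ?case
    using opn_model[OF App.prems] by (simp del: map_eq_conv)
qed (simp_all add: atm_model act_model abst_model)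

end


section \<open>Completeness\<close>

text \<open>\<open>D\<close>, \<open>F\<close>, \<open>K\<close> and \<open>G\<close> stay those of
  the original context while \<open>cs\<close> grows under abstractions. The assumptions on
  \<open>F_atoms\<close>, \<open>P_perms\<close> and the atoms of the terms relate the current list
  to them and are maintained by the induction.\<close>

lemma aeq_imp_derives:
  fixes t u :: "('a, 'v, 'f) trm"
  assumes inf: "infinite (UNIV :: 'a set)" and fin: "finite \<Upsilon>"
    and K: "\<And>X. K X = generate perm_group (P X)" "\<And>X k. k \<in> K X \<Longrightarrow> affected k \<subseteq> D - F X"
    and G: "\<And>X. G X = {\<pi>. \<exists>k\<in>K X. \<forall>a\<in>D - F X. \<pi> \<langle>$\<rangle> a = k \<langle>$\<rangle> a}"
    and "aeq C G t u" "atoms_trm t \<subseteq> D \<union> set cs" "atoms_trm u \<subseteq> D \<union> set cs"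
    and "\<And>X. F_atoms cs \<Upsilon> X = F X \<union> set cs" "\<And>X. P_perms cs \<Upsilon> X = P X"
  shows "derives C \<Upsilon> cs t u"
  using assms(6-)
proof (induction arbitrary: cs rule: aeq.induct)
  case (atom a)
  show ?case by (rule derives.atom)
next
  case (var \<pi>' \<pi> X)
  let ?\<tau> = "inverse \<pi>' * \<pi>"
  obtain k where k: "k \<in> K X" "\<And>a. a \<in> D - F X \<Longrightarrow> ?\<tau> \<langle>$\<rangle> a = k \<langle>$\<rangle> a"
    using var.hyps unfolding G by blast
  have k_inv: "inverse k \<langle>$\<rangle> a = a" if "a \<notin> D - F X" for a
    using that K(2)[OF k(1)] by (intro apply_outside_affected) auto
  have k_maps: "inverse k \<langle>$\<rangle> a \<in> D - F X" if "a \<in> D - F X" for a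
    using that K(2)[OF k(1)] by (intro apply_in_superset_affected) simp_all
  have \<tau>: "affected ?\<tau> \<subseteq> D \<union> set cs"
    using affected_times[of "inverse \<pi>'" \<pi>] var.prems(1,2) by auto
  \<comment> \<open>\<open>?\<tau>\<close> is factored as \<open>?\<tau> * inverse k\<close> times
    \<open>k\<close>. On \<open>D - F X\<close>, which \<open>k\<close> preserves,
    \<open>?\<tau>\<close> and \<open>k\<close> agree; outside \<open>D\<close> and
    \<open>cs\<close> both fix every atom. So the first factor moves only atoms of
    \<open>F_atoms cs \<Upsilon> X\<close>.\<close>
  have "(?\<tau> * inverse k) \<langle>$\<rangle> a = a" if a: "a \<notin> F X \<union> set cs" for a
  proof (cases "a \<in> D")
    case True
    then have "a \<in> D - F X"
      using a by simp
    from k(2)[OF k_maps[OF this]] show ?thesis by simp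
  next
    case False
    then have "?\<tau> \<langle>$\<rangle> a = a"
      using a \<tau> by (intro apply_outside_affected) auto
    then show ?thesis
      using False by (simp add: k_inv)
  qed
  then have "affected (?\<tau> * inverse k) \<subseteq> F X \<union> set cs"
    unfolding in_affected subset_iff by blast
  then have "?\<tau> * inverse k * k \<in> PN cs \<Upsilon> X"
    unfolding PN_def Perms_on_def var.prems(3,4) K(1)[symmetric] using k(1) by blast
  then show ?case
    by (intro derives.var) (simp add: mult.assoc)
next
  case (app f ts us)
  have "derives C \<Upsilon> cs (ts ! i) (us ! i)" if i: "i < length ts" for i
  proof -
    have "ts ! i \<in> set ts" "us ! i \<in> set us"
      using i app.IH by (auto simp: list_all2_conv_all_nth)
    then have "atoms_trm (ts ! i) \<subseteq> D \<union> set cs" "atoms_trm (us ! i) \<subseteq> D \<union> set cs"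
      using app.prems(1,2) by auto
    then show ?thesis
      using app.IH i app.prems(3,4) by (simp add: list_all2_conv_all_nth)
  qed
  then show ?case
    using app.hyps list_all2_lengthD[OF app.IH]
    by (intro derives.app) (simp_all add: list_all2_conv_all_nth)
next
  case (comm f s\<^sub>0 t\<^sub>0 s\<^sub>1 t\<^sub>1)
  then show ?case
    by (intro derives.comm) auto
next
  case (abs L a t b s)
  have fin': "finite (L \<union> (atoms_ctx cs \<Upsilon> \<union> {a, b} \<union> atoms_trm t \<union> atoms_trm s))"
    using fin abs.hyps by (auto simp: atoms_ctx_def finite_atoms_trm)
  \<comment> \<open>\<open>c\<close> avoids \<open>L\<close> for the induction hypothesis and the
    other atoms for \<open>abs_diff\<close>, which is used even when \<open>a\<close> and
    \<open>b\<close> coincide.\<close>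
  obtain c where c: "c \<notin> L \<union> (atoms_ctx cs \<Upsilon> \<union> {a, b} \<union> atoms_trm t \<union> atoms_trm s)"
    using ex_new_if_finite[OF inf fin'] by (rule exE)
  then have c_ctx: "c \<notin> atoms_ctx cs \<Upsilon>"
    by simp
  have atoms: "atoms_trm (perm_trm \<langle>d \<leftrightarrow> c\<rangle> r) \<subseteq> D \<union> set (cs @ [c])"
    if "atoms_trm (Abs d r) \<subseteq> D \<union> set cs" for d and r :: "('a, 'v, 'f) trm"
    using that atoms_perm_trm[of "\<langle>d \<leftrightarrow> c\<rangle>" r] affected_swap_subset[of d c] by auto
  have "derives C \<Upsilon> (cs @ [c]) (perm_trm \<langle>a \<leftrightarrow> c\<rangle> t) (perm_trm \<langle>b \<leftrightarrow> c\<rangle> s)"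
  proof (rule abs.IH)
    show "F_atoms (cs @ [c]) \<Upsilon> X = F X \<union> set (cs @ [c])" for X
      using abs.prems(3) by (simp add: F_atoms_snoc_fresh[OF c_ctx])
    show "P_perms (cs @ [c]) \<Upsilon> X = P X" for X
      using abs.prems(4) by (simp add: P_perms_snoc_fresh[OF c_ctx])
  qed (use c atoms abs.prems(1,2) in auto)
  then show ?case
    using c by (intro derives.abs_diff) auto
qed

text \<open>Validity is assumed for carriers made of sets of terms because it is applied to the term
  model for the groups \<open>G X\<close>.\<close>

lemma derives_complete:
  fixes t u :: "('a, 'v, 'f) trm"
  assumes inf: "infinite (UNIV :: 'a set)" and sig: "comm_signature ar C"
    and ctx: "fp_context cs \<Upsilon>" and wf: "wf_trm ar t" "wf_trm ar u"
    and valid: "\<And>(A :: ('a, 'f, ('a, 'v, 'f) trm set) nom_alg) \<sigma>.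
      comm_nom_alg ar C A \<Longrightarrow> range \<sigma> \<subseteq> univ A \<Longrightarrow> judgement_valid A \<sigma> cs \<Upsilon> t u"
  shows "derives C \<Upsilon> cs t u"
proof -
  define D where "D = atoms_ctx cs \<Upsilon> \<union> atoms_trm t \<union> atoms_trm u"
  define F where "F = F_atoms cs \<Upsilon>"
  define K where "K X = generate perm_group (P_perms cs \<Upsilon> X)" for X
  define G where "G X = {\<pi>. \<exists>k\<in>K X. \<forall>a\<in>D - F X. \<pi> \<langle>$\<rangle> a = k \<langle>$\<rangle> a}" for X
  have cs: "set cs \<subseteq> F X" "set cs \<subseteq> D" for X
    by (auto simp: F_def F_atoms_def D_def atoms_ctx_def)
  have fin: "finite D" "finite \<Upsilon>"
    using finite_atoms_ctx[OF ctx] ctx by (auto simp: D_def finite_atoms_trm fp_context_def)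
  note K_group = generate_perm_group[OF K_def]
  have K_affected: "affected k \<subseteq> D - F X" if "k \<in> K X" for k X
  proof (rule affected_generate)
    show "k \<in> generate perm_group (P_perms cs \<Upsilon> X)"
      using that by (simp add: K_def)
  qed (use affected_P_perms[OF ctx, of _ X] in \<open>auto simp: D_def F_def\<close>)
  \<comment> \<open>Since \<open>K X\<close> preserves \<open>D - F X\<close>, agreement on this set
    is compatible with products and inverses, which makes \<open>G X\<close> a group.\<close>
  have K_maps: "k \<langle>$\<rangle> a \<in> D - F X" if "k \<in> K X" "a \<in> D - F X" for k a X
    by (rule apply_in_superset_affected[OF K_affected[OF that(1)] that(2)])
  have G_I: "\<pi> \<in> G X" if "\<And>a. a \<in> D - F X \<Longrightarrow> \<pi> \<langle>$\<rangle> a = a" for \<pi> X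
    unfolding G_def using that K_group(1)[of X] by (auto intro!: bexI[of _ 1])
  interpret stabilisers ar C G
  proof
    show "1 \<in> G X" for X
      by (rule G_I) simp
    show "inverse \<pi> \<in> G X" if "\<pi> \<in> G X" for \<pi> X
    proof -
      from that obtain k where k: "k \<in> K X" "\<And>a. a \<in> D - F X \<Longrightarrow> \<pi> \<langle>$\<rangle> a = k \<langle>$\<rangle> a"
        unfolding G_def by blast
      have "inverse \<pi> \<langle>$\<rangle> a = inverse k \<langle>$\<rangle> a" if "a \<in> D - F X" for a
        using k(2)[OF K_maps[OF K_group(2)[OF k(1)] that]] by (metis apply_inverse_cancel)
      then show ?thesis
        unfolding G_def using K_group(2)[OF k(1)] by blast
    qed
    show "\<pi> * \<pi>' \<in> G X" if \<pi>: "\<pi> \<in> G X" "\<pi>' \<in> G X" for \<pi> \<pi>' X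
    proof -
      from \<pi>(1) obtain k where k: "k \<in> K X" "\<And>a. a \<in> D - F X \<Longrightarrow> \<pi> \<langle>$\<rangle> a = k \<langle>$\<rangle> a"
        unfolding G_def by blast
      from \<pi>(2) obtain l where l: "l \<in> K X" "\<And>a. a \<in> D - F X \<Longrightarrow> \<pi>' \<langle>$\<rangle> a = l \<langle>$\<rangle> a"
        unfolding G_def by blast
      have "(\<pi> * \<pi>') \<langle>$\<rangle> a = (k * l) \<langle>$\<rangle> a" if "a \<in> D - F X" for a
        using k(2)[OF K_maps[OF l(1) that]] l(2)[OF that] by simp
      then show ?thesis
        unfolding G_def using K_group(3)[OF k(1) l(1)] by blast
    qed
    show "\<exists>S. finite S \<and> (\<forall>\<pi>. affected \<pi> \<inter> S = {} \<longrightarrow> \<pi> \<in> G X)" for X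
    proof (intro exI[of _ D] conjI allI impI)
      fix \<pi> :: "'a perm" assume "affected \<pi> \<inter> D = {}"
      then show "\<pi> \<in> G X"
        by (intro G_I apply_outside_affected) auto
    qed (rule fin(1))
  qed (fact sig)
  \<comment> \<open>As \<open>cs\<close> lies in \<open>F X\<close>, replacing it by names outside
    \<open>D\<close> does not touch \<open>D - F X\<close>. The same fact puts the renaming itself
    into every \<open>G X\<close> below.\<close>
  have swaps: "swaps cs ds \<langle>$\<rangle> a = a" if "set ds \<inter> D = {}" "a \<in> D - F X" for ds a X
    using that cs(1)[of X] by (intro swaps_outside) auto
  let ?\<sigma> = "\<lambda>X. cls (Susp 1 X)"
  have "context_valid model ?\<sigma> cs \<Upsilon>"
    unfolding context_valid_def
  proof (intro ballI, clarify, rule new_quantI[OF fin(1)])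
    fix \<pi> X and ds :: "'a list"
    assume \<pi>: "(\<pi>, X) \<in> \<Upsilon>" and ds: "set ds \<inter> D = {}"
    let ?\<pi>' = "rename_perm (swaps cs ds) \<pi>"
    \<comment> \<open>A constraint meeting \<open>cs\<close> moves only atoms of \<open>F X\<close>
      and stays trivial on \<open>D - F X\<close> after renaming; one avoiding \<open>cs\<close> is
      unchanged by renaming and is a generator of \<open>K X\<close>.\<close>
    have "?\<pi>' \<in> G X"
      using fp_context_split[OF ctx \<pi>]
    proof (elim disjE conjE)
      assume "\<pi> = cycles_meeting cs \<pi>"
      then have sub: "affected \<pi> \<subseteq> F X"
        using \<pi> by (auto simp: F_def F_atoms_def)
      show ?thesis
      proof (rule G_I)
        fix a assume a: "a \<in> D - F X"
        have "swaps cs ds \<langle>$\<rangle> a = a"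
          by (rule swaps[OF ds a])
        moreover from this have "inverse (swaps cs ds) \<langle>$\<rangle> a = a"
          by (metis apply_inverse_cancel(2))
        moreover have "\<pi> \<langle>$\<rangle> a = a"
          using sub a by (intro apply_outside_affected) auto
        ultimately show "?\<pi>' \<langle>$\<rangle> a = a"
          by (simp add: rename_perm_def)
      qed
    next
      assume "\<pi> = cycles_avoiding cs \<pi>"
      then have P: "\<pi> \<in> P_perms cs \<Upsilon> X"
        using \<pi> unfolding P_perms_def by blast
      then have "affected \<pi> \<subseteq> D - F X"
        by (intro K_affected K_group(4))
      then have "?\<pi>' = \<pi>"
        using affected_swaps[of cs ds] cs(1)[of X] ds by (intro rename_perm_id) blast
      then show ?thesis
        unfolding G_def using K_group(4)[OF P] by auto
    qed
    then have "aeq C G (Susp (?\<pi>' * 1) X) (Susp 1 X)"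
      by (intro aeq.var) (simp add: perm.inverse_neutral)
    then show "act model ?\<pi>' (?\<sigma> X) = ?\<sigma> X"
      by (simp add: act_model cls_eqI)
  qed
  moreover have "judgement_valid model ?\<sigma> cs \<Upsilon> t u"
    by (intro valid comm_nom_alg_model) (auto simp: univ_model)
  ultimately have "new_quant (length cs) (\<lambda>ds. interp model ?\<sigma> (rename_trm (swaps cs ds) t) =
      interp model ?\<sigma> (rename_trm (swaps cs ds) u))"
    by (simp add: judgement_valid_def)
  then obtain ds where ds: "set ds \<inter> D = {}" "interp model ?\<sigma> (rename_trm (swaps cs ds) t) =
      interp model ?\<sigma> (rename_trm (swaps cs ds) u)"
    by (rule new_quantE[OF inf fin(1)])
  let ?\<rho> = "swaps cs ds"
  have \<rho>: "?\<rho> \<in> G X" for X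
    by (rule G_I) (rule swaps[OF ds(1)])
  have "aeq C G (rename_trm ?\<rho> t) (rename_trm ?\<rho> u)"
    using ds(2) wf by (simp add: interp_model cls_eq_iff)
  \<comment> \<open>\<open>?\<rho>\<close> lies in every \<open>G X\<close>, so renaming may be
    exchanged for the action, which \<open>inverse ?\<rho>\<close> then undoes.\<close>
  then have "aeq C G (perm_trm ?\<rho> t) (perm_trm ?\<rho> u)"
    using rename_trm_aeq_perm_trm[OF \<rho> wf(1)] rename_trm_aeq_perm_trm[OF \<rho> wf(2)]
    by (meson aeq_sym aeq_trans)
  then have aeq: "aeq C G t u"
    using aeq_perm_trm[of C G "perm_trm ?\<rho> t" "perm_trm ?\<rho> u" "inverse ?\<rho>"]
    by (simp flip: perm_trm_times)
  show ?thesis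
  proof (rule aeq_imp_derives[OF inf fin(2) K_def _ G_def aeq])
    show "affected k \<subseteq> D - F X" if "k \<in> K X" for k X
      using that by (rule K_affected)
    show "atoms_trm t \<subseteq> D \<union> set cs" "atoms_trm u \<subseteq> D \<union> set cs"
      by (auto simp: D_def)
    show "F_atoms cs \<Upsilon> X = F X \<union> set cs" for X
      using cs(1)[of X] by (auto simp: F_def)
  qed simp
qed

theorem theorem2:
  fixes ar :: "'f \<Rightarrow> nat" and C :: "'f \<Rightarrow> bool"
    and cs :: "'a list" and \<Upsilon> :: "('a, 'v) constraints"
    and t u :: "('a, 'v, 'f) trm"
  assumes "infinite (UNIV :: 'a set)" and "countable (UNIV :: 'a set)"
    and "infinite (UNIV :: 'v set)" and "countable (UNIV :: 'v set)"
    and "comm_signature ar C"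
    and "fp_context cs \<Upsilon>"
    and "wf_trm ar t" and "wf_trm ar u"
  shows "(derives C \<Upsilon> cs t u \<longrightarrow> entails TYPE('x) ar C \<Upsilon> cs t u) \<and>
    (entails TYPE(('a, 'v, 'f) trm set) ar C \<Upsilon> cs t u \<longrightarrow> derives C \<Upsilon> cs t u)"
proof (intro conjI impI)
  assume "derives C \<Upsilon> cs t u"
  then show "entails TYPE('x) ar C \<Upsilon> cs t u"
    unfolding entails_def using derives_sound[OF assms(1,6-8)] by blast
next
  assume "entails TYPE(('a, 'v, 'f) trm set) ar C \<Upsilon> cs t u"
  then show "derives C \<Upsilon> cs t u"
    unfolding entails_def by (intro derives_complete[OF assms(1,5-8)]) blast
qed

end
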